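(* Let $(W,S)$ be a Coxeter system with $S$ finite, and let $\Gamma=\Gamma(W,S)$ be the Cayley graph of $W$ with respect to the generating set $S$. Then: (a) Every element of $\operatorname{Aut}(\Gamma)$ is the composition of a left-multiplication automorphism and a diagram automorphism if and only if the defining diagram of $(W,S)$ is not flexible. (b) $\operatorname{Aut}(\Gamma)$ is a discrete group if and only if the defining diagram of $(W,S)$ is not flexible.
   Context: A Coxeter system $(W,S)$ is a group $W$ with generating set $S$ and presentation $\langle S \mid s^2\ (s\in S),\ (st)^{m_{st}}\ (s\neq t\in S,\ m_{st}<\infty)\rangle$, where $m_{st}=m_{ts}\in\{2,3,\dots\}\cup\{\infty\}$ is the order of $st$ for $s \ne t$. The Cayley graph $\Gamma(W,S)$ is the undirected graph with vertex set $W$ and a single edge between $w$ and $ws$, labelled $s$, for each $w\in W$, $s\in S$. $\operatorname{Aut}(\Gamma)$ is the group of graph automorphisms, which are not required to preserve edge labels; it carries the usual topology of pointwise convergence on vertices (a neighbourhood basis of the identity is given by the pointwise stabilisers of finite sets of vertices). The defining diagram of $(W,S)$ is the labelled graph with vertex set $S$, with an edge between distinct $s,t$ if and only if $m_{st}<\infty$, this edge being labelled $m_{st}$. It is flexible if there are a vertex $s\in S$ and a nontrivial label-preserving automorphism $\phi$ of the defining diagram such that $\phi$ fixes $s$ and fixes every vertex joined to $s$ by an edge of the defining diagram. A left-multiplication automorphism of $\Gamma$ is a map $L_w(x)=wx$ with $w\in W$. An automorphism of the Coxeter diagram is a permutation $\pi$ of $S$ with $m_{\pi(s)\pi(t)}=m_{st}$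 for all distinct $s,t\in S$; a diagram automorphism of $\Gamma$ is the automorphism of $\Gamma$ given on vertices by the group automorphism of $W$ extending such a permutation $\pi$. *)

theory Defs
  imports
    "HOL-Algebra.Multiplicative_Group"
    "HOL-Algebra.Generated_Groups"
    "HOL-Algebra.Bij"
    "HOL-Analysis.Function_Topology"
    "HOL-Library.Extended_Nat"
begin

text \<open>
  Elements of the free group on \<open>S\<close> are represented by words in signed letters:
  \<open>(True, s)\<close> stands for \<open>s\<close> and \<open>(False, s)\<close> for the formal inverse of \<open>s\<close>.
\<close>

type_synonym 'a signed_word = "(bool \<times> 'a) list"

definition signed_words :: "'a set \<Rightarrow> 'a signed_word set" where
  "signed_words S = lists (UNIV \<times> S)"

definition letter_value :: "('a, 'b) monoid_scheme \<Rightarrow> bool \<times> 'a \<Rightarrow> 'a" where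
  "letter_value G l = (if fst l then snd l else m_inv G (snd l))"

definition word_value :: "('a, 'b) monoid_scheme \<Rightarrow> 'a signed_word \<Rightarrow> 'a" where
  "word_value G w = foldr (\<lambda>l x. letter_value G l \<otimes>\<^bsub>G\<^esub> x) w \<one>\<^bsub>G\<^esub>"

text \<open>
  Equality in \<open>F(S)/\<langle>\<langle>R\<rangle>\<rangle>\<close>: the congruence on signed words generated by free cancellation
  and by deletion of relators.
\<close>

inductive presentation_eq :: "'a set \<Rightarrow> 'a signed_word set \<Rightarrow> 'a signed_word \<Rightarrow> 'a signed_word \<Rightarrow> bool"
  for S :: "'a set" and R :: "'a signed_word set" where
  refl: "presentation_eq S R u u"
| sym: "presentation_eq S R u v \<Longrightarrow> presentation_eq S R v u"
| trans: "presentation_eq S R u v \<Longrightarrow> presentation_eq S R v w \<Longrightarrow> presentation_eq S R u w"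
| cancel: "s \<in> S \<Longrightarrow> presentation_eq S R (u @ [(b, s), (\<not> b, s)] @ v) (u @ v)"
| relator: "r \<in> R \<Longrightarrow> presentation_eq S R (u @ r @ v) (u @ v)"

text \<open>
  \<open>G = \<langle>S | R\<rangle>\<close>: the canonical homomorphism from the free group on \<open>S\<close> to \<open>G\<close> is onto, and
  its kernel is the normal closure of \<open>R\<close>.
\<close>

definition has_presentation ::
    "('a, 'b) monoid_scheme \<Rightarrow> 'a set \<Rightarrow> 'a signed_word set \<Rightarrow> bool" where
  "has_presentation G S R \<longleftrightarrow>
     group G \<and> S \<subseteq> carrier G \<and> R \<subseteq> signed_words S \<and>
     generate G S = carrier G \<and>
     (\<forall>w \<in> signed_words S. word_value G w = \<one>\<^bsub>G\<^esub> \<longleftrightarrow> presentation_eq S R w [])"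

text \<open>The library's \<^const>\<open>group.ord\<close> is \<open>0\<close> on elements of infinite order.\<close>

definition coxeter_order :: "('a, 'b) monoid_scheme \<Rightarrow> 'a \<Rightarrow> 'a \<Rightarrow> enat" where
  "coxeter_order W s t =
     (if group.ord W (s \<otimes>\<^bsub>W\<^esub> t) = 0 then \<infinity> else enat (group.ord W (s \<otimes>\<^bsub>W\<^esub> t)))"

definition coxeter_relators :: "('a, 'b) monoid_scheme \<Rightarrow> 'a set \<Rightarrow> 'a signed_word set" where
  "coxeter_relators W S =
     {[(True, s), (True, s)] | s. s \<in> S} \<union>
     {concat (replicate n [(True, s), (True, t)]) | s t n.
        s \<in> S \<and> t \<in> S \<and> s \<noteq> t \<and> coxeter_order W s t = enat n}"

definition coxeter_system :: "('a, 'b) monoid_scheme \<Rightarrow> 'a set \<Rightarrow> bool" where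
  "coxeter_system W S \<longleftrightarrow> has_presentation W S (coxeter_relators W S)"

text \<open>
  A simple graph is given by its vertex set \<open>V\<close> and its set \<open>E\<close> of unordered edges.  As in
  \<^const>\<open>BijGroup\<close>, automorphisms are extensional functions on \<open>V\<close>.
\<close>

definition graph_aut_group :: "'a set \<Rightarrow> 'a set set \<Rightarrow> ('a \<Rightarrow> 'a) monoid" where
  "graph_aut_group V E = BijGroup V
     \<lparr>carrier := {f \<in> Bij V. \<forall>x\<in>V. \<forall>y\<in>V. {f x, f y} \<in> E \<longleftrightarrow> {x, y} \<in> E}\<rparr>"

text \<open>Pointwise convergence on \<open>V\<close>, each factor \<open>V\<close> being discrete.\<close>

definition graph_aut_topology :: "'a set \<Rightarrow> 'a set set \<Rightarrow> ('a \<Rightarrow> 'a) topology" where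
  "graph_aut_topology V E =
     subtopology (product_topology (\<lambda>_. discrete_topology V) V) (carrier (graph_aut_group V E))"

definition cayley_edges :: "('a, 'b) monoid_scheme \<Rightarrow> 'a set \<Rightarrow> 'a set set" where
  "cayley_edges W S = {{w, w \<otimes>\<^bsub>W\<^esub> s} | w s. w \<in> carrier W \<and> s \<in> S}"

definition cayley_aut_group :: "('a, 'b) monoid_scheme \<Rightarrow> 'a set \<Rightarrow> ('a \<Rightarrow> 'a) monoid" where
  "cayley_aut_group W S = graph_aut_group (carrier W) (cayley_edges W S)"

definition cayley_aut_topology :: "('a, 'b) monoid_scheme \<Rightarrow> 'a set \<Rightarrow> ('a \<Rightarrow> 'a) topology" where
  "cayley_aut_topology W S = graph_aut_topology (carrier W) (cayley_edges W S)"

definition left_mult :: "('a, 'b) monoid_scheme \<Rightarrow> 'a \<Rightarrow> 'a \<Rightarrow> 'a" where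
  "left_mult W w = (\<lambda>x\<in>carrier W. w \<otimes>\<^bsub>W\<^esub> x)"

definition left_mult_automorphisms :: "('a, 'b) monoid_scheme \<Rightarrow> ('a \<Rightarrow> 'a) set" where
  "left_mult_automorphisms W = left_mult W ` carrier W"

definition coxeter_diagram_automorphism ::
    "('a, 'b) monoid_scheme \<Rightarrow> 'a set \<Rightarrow> ('a \<Rightarrow> 'a) \<Rightarrow> bool" where
  "coxeter_diagram_automorphism W S \<pi> \<longleftrightarrow>
     bij_betw \<pi> S S \<and>
     (\<forall>s\<in>S. \<forall>t\<in>S. s \<noteq> t \<longrightarrow> coxeter_order W (\<pi> s) (\<pi> t) = coxeter_order W s t)"

definition diagram_automorphisms :: "('a, 'b) monoid_scheme \<Rightarrow> 'a set \<Rightarrow> ('a \<Rightarrow> 'a) set" where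
  "diagram_automorphisms W S =
     {\<delta> \<in> auto W. \<exists>\<pi>. coxeter_diagram_automorphism W S \<pi> \<and> (\<forall>s\<in>S. \<delta> s = \<pi> s)}"

definition defining_diagram_edges :: "('a, 'b) monoid_scheme \<Rightarrow> 'a set \<Rightarrow> 'a set set" where
  "defining_diagram_edges W S =
     {{s, t} | s t. s \<in> S \<and> t \<in> S \<and> s \<noteq> t \<and> coxeter_order W s t < \<infinity>}"

definition defining_diagram_automorphisms ::
    "('a, 'b) monoid_scheme \<Rightarrow> 'a set \<Rightarrow> ('a \<Rightarrow> 'a) set" where
  "defining_diagram_automorphisms W S =
     {\<phi> \<in> carrier (graph_aut_group S (defining_diagram_edges W S)).
        \<forall>s t. {s, t} \<in> defining_diagram_edges W S \<longrightarrow>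
          coxeter_order W (\<phi> s) (\<phi> t) = coxeter_order W s t}"

definition flexible :: "('a, 'b) monoid_scheme \<Rightarrow> 'a set \<Rightarrow> bool" where
  "flexible W S \<longleftrightarrow>
     (\<exists>s\<in>S. \<exists>\<phi>\<in>defining_diagram_automorphisms W S.
        (\<exists>t\<in>S. \<phi> t \<noteq> t) \<and> \<phi> s = s \<and>
        (\<forall>t\<in>S. {s, t} \<in> defining_diagram_edges W S \<longrightarrow> \<phi> t = t))"

lemma group_graph_aut_group: "group (graph_aut_group V E)"
proof -
  let ?A = "{f \<in> Bij V. \<forall>x\<in>V. \<forall>y\<in>V. {f x, f y} \<in> E \<longleftrightarrow> {x, y} \<in> E}"
  interpret B: group "BijGroup V" by (rule group_BijGroup)
  have mem: "f x \<in> V" if "f \<in> Bij V" "x \<in> V" for f x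
    using that Bij_imp_funcset by blast
  have inv: "inv_into V f x \<in> V" "f (inv_into V f x) = x" if "f \<in> Bij V" "x \<in> V" for f x
    using that by (auto simp: Bij_def bij_betw_def intro: inv_into_into f_inv_into_f)
  have "subgroup ?A (BijGroup V)"
  proof (rule B.subgroupI)
    show "?A \<subseteq> carrier (BijGroup V)" by (auto simp: BijGroup_def)
    have "(\<lambda>x\<in>V. x) \<in> ?A" using id_Bij by simp
    then show "?A \<noteq> {}" by blast
  next
    fix f assume f: "f \<in> ?A"
    then have fB: "f \<in> Bij V" by blast
    have "{inv_into V f x, inv_into V f y} \<in> E \<longleftrightarrow> {x, y} \<in> E" if "x \<in> V" "y \<in> V" for x y
      using f inv[OF fB that(1)] inv[OF fB that(2)] by force
    then show "m_inv (BijGroup V) f \<in> ?A"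
      using fB by (simp add: inv_BijGroup restrict_inv_into_Bij)
  next
    fix f g assume "f \<in> ?A" "g \<in> ?A"
    then show "f \<otimes>\<^bsub>BijGroup V\<^esub> g \<in> ?A"
      by (auto simp: BijGroup_def compose_Bij compose_eq mem)
  qed
  then show ?thesis
    unfolding graph_aut_group_def by (rule B.subgroup_imp_group)
qed

lemma coxeter_generator_involution:
  assumes "coxeter_system W S" and "s \<in> S"
  shows "s \<otimes>\<^bsub>W\<^esub> s = \<one>\<^bsub>W\<^esub>"
proof -
  let ?r = "[(True, s), (True, s)]" and ?R = "coxeter_relators W S"
  have P: "has_presentation W S ?R" using assms(1) by (simp add: coxeter_system_def)
  then interpret group W by (simp add: has_presentation_def)
  have "?r \<in> ?R" using assms(2) by (auto simp: coxeter_relators_def)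
  from presentation_eq.relator[OF this, of S "[]" "[]"] have "presentation_eq S ?R ?r []" by simp
  moreover have "?r \<in> signed_words S" using assms(2) by (simp add: signed_words_def)
  ultimately have "word_value W ?r = \<one>\<^bsub>W\<^esub>" using P by (simp add: has_presentation_def)
  moreover have "s \<in> carrier W" using P assms(2) by (auto simp: has_presentation_def)
  ultimately show ?thesis by (simp add: word_value_def letter_value_def)
qed

lemma coxeter_order_commute:
  assumes "coxeter_system W S" and "s \<in> S" and "t \<in> S"
  shows "coxeter_order W s t = coxeter_order W t s"
proof -
  interpret group W using assms(1) by (simp add: coxeter_system_def has_presentation_def)
  have c: "s \<in> carrier W" "t \<in> carrier W"
    using assms by (auto simp: coxeter_system_def has_presentation_def)
  have "m_inv W s = s" "m_inv W t = t"
    using assms c coxeter_generator_involution by (metis inv_equality)+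
  then have "m_inv W (s \<otimes>\<^bsub>W\<^esub> t) = t \<otimes>\<^bsub>W\<^esub> s" using c by (simp add: inv_mult_group)
  then have "ord (t \<otimes>\<^bsub>W\<^esub> s) = ord (s \<otimes>\<^bsub>W\<^esub> t)" using c by (metis ord_inv m_closed)
  then show ?thesis by (simp add: coxeter_order_def)
qed

lemma coxeter_order_ge_2:
  assumes "coxeter_system W S" and "s \<in> S" and "t \<in> S" and "s \<noteq> t"
  shows "coxeter_order W s t \<ge> 2"
proof -
  interpret group W using assms(1) by (simp add: coxeter_system_def has_presentation_def)
  have c: "s \<in> carrier W" "t \<in> carrier W"
    using assms by (auto simp: coxeter_system_def has_presentation_def)
  have "s \<otimes>\<^bsub>W\<^esub> t \<noteq> \<one>\<^bsub>W\<^esub>"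
    using assms c coxeter_generator_involution[OF assms(1,3)] by (metis right_cancel)
  then have "ord (s \<otimes>\<^bsub>W\<^esub> t) \<noteq> 1" using c ord_eq_1 by blast
  then show ?thesis by (auto simp: coxeter_order_def numeral_eq_enat)
qed

end

theory Submission
  imports Defs
begin

text \<open>
  An automorphism \<open>f\<close> of the Cayley graph induces at every vertex \<open>x\<close> a permutation \<open>\<sigma>\<^sub>x\<close> of the
  labels, \<open>f (x s) = f x \<sigma>\<^sub>x(s)\<close>.  The longest element of a finite dihedral subgroup \<open>\<langle>s, t\<rangle>\<close> is the
  shortest element with left descents \<open>s\<close> and \<open>t\<close>, so it is recognised by the metric; hence \<open>\<sigma>\<^sub>x\<close>
  preserves the orders \<open>m\<^sub>s\<^sub>t\<close>, and \<open>\<sigma>\<^sub>x\<close> and \<open>\<sigma>\<^sub>x\<^sub>s\<close> agree on \<open>s\<close> and on all \<open>t\<close> with \<open>m\<^sub>s\<^sub>t\<close> finite.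
  If the diagram is not flexible, all \<open>\<sigma>\<^sub>x\<close> coincide, and \<open>f\<close> is a left multiplication composed with a
  diagram automorphism; such maps are determined by their values on \<open>{\<one>} \<union> S\<close>, whence discreteness.

  Conversely, let \<open>\<phi>\<close> fix the star of \<open>s\<close> and move \<open>t\<close>.  For a coset \<open>B\<close> of \<open>\<langle>S - {s}\<rangle>\<close> there is an
  automorphism with \<open>\<sigma>\<^sub>x = \<phi>\<close> on \<open>B\<close> and trivial \<open>\<sigma>\<^sub>x\<close> elsewhere, since the relators can be checked cycle
  by cycle.  As \<open>m\<^sub>s\<^sub>t = \<infinity>\<close>, there are infinitely many such cosets, so \<open>B\<close> can be
  chosen to avoid any given finite set of vertices.
\<close>

section \<open>Words, their values, and the universal property of the presentation\<close>

locale coxeter = group W for W :: "('a, 'b) monoid_scheme" (structure) +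
  fixes S :: "'a set"
  assumes coxeter_system: "coxeter_system W S"
begin

lemma has_presentation: "has_presentation W S (coxeter_relators W S)"
  using coxeter_system by (simp add: coxeter_system_def)

lemma generator_closed [simp, intro]: "s \<in> S \<Longrightarrow> s \<in> carrier W"
  using has_presentation by (auto simp: has_presentation_def)

lemma generator_square [simp]: "s \<in> S \<Longrightarrow> s \<otimes> s = \<one>"
  using coxeter_generator_involution[OF coxeter_system] .

lemma generator_inv [simp]: "s \<in> S \<Longrightarrow> inv s = s"
  by (simp add: inv_equality)

lemma generator_cancel_left [simp]: "s \<in> S \<Longrightarrow> x \<in> carrier W \<Longrightarrow> s \<otimes> (s \<otimes> x) = x"
  by (simp flip: m_assoc)

lemma generator_cancel_right [simp]: "s \<in> S \<Longrightarrow> x \<in> carrier W \<Longrightarrow> x \<otimes> s \<otimes> s = x"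
  by (simp add: m_assoc)

lemma coxeter_order_enat:
  assumes "s \<in> S" "t \<in> S"
  shows "coxeter_order W s t = enat n \<longleftrightarrow> n > 0 \<and> ord (s \<otimes> t) = n"
  by (auto simp: coxeter_order_def)

declare in_lists_conv_set [simp]

text \<open>Unsigned words suffice because every generator is its own inverse; signed words enter
  only where the presentation itself is used.\<close>

definition val :: "'a list \<Rightarrow> 'a" where
  "val ws = foldr (\<otimes>) ws \<one>"

lemma val_simps [simp]: "val [] = \<one>" "val (a # ws) = a \<otimes> val ws"
  by (simp_all add: val_def)

lemma val_closed [simp, intro]: "ws \<in> lists S \<Longrightarrow> val ws \<in> carrier W"
  by (induction ws) auto

lemma val_append: "us \<in> lists S \<Longrightarrow> vs \<in> lists S \<Longrightarrow> val (us @ vs) = val us \<otimes> val vs"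
  by (induction us) (auto simp: m_assoc)

lemma val_rev: "ws \<in> lists S \<Longrightarrow> val (rev ws) = inv (val ws)"
  by (induction ws) (auto simp: val_append inv_mult_group)

lemma word_value_unsigned: "word_value W (map (Pair True) ws) = val ws"
  by (induction ws) (auto simp: word_value_def letter_value_def)

lemma parabolic_word:
  assumes "J \<subseteq> S" "w \<in> generate W J"
  shows "\<exists>ws\<in>lists J. val ws = w"
  using assms(2)
proof (induction rule: generate.induct)
  case one
  then show ?case by (intro bexI[of _ "[]"]) auto
next
  case (incl h)
  then show ?case using assms(1) by (intro bexI[of _ "[h]"]) auto
next
  case (inv h)
  then show ?case using assms(1) by (intro bexI[of _ "[h]"]) auto
next
  case (eng h1 h2)
  then obtain u v where "u \<in> lists J" "v \<in> lists J" "val u = h1" "val v = h2" by blast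
  then show ?case
    using assms(1) by (intro bexI[of _ "u @ v"]) (auto simp: val_append subset_iff)
qed

lemma val_surj:
  assumes "w \<in> carrier W"
  obtains ws where "ws \<in> lists S" "val ws = w"
  using parabolic_word[of S w] assms has_presentation that
  by (auto simp: has_presentation_def)

text \<open>Induction along a path of the Cayley graph starting at \<open>\<one>\<close>: edges are
  right multiplications, so the new letter is appended on the right.\<close>

lemma generator_induct [consumes 1, case_names one step]:
  assumes "w \<in> carrier W" and "P \<one>"
    and step: "\<And>w s. w \<in> carrier W \<Longrightarrow> P w \<Longrightarrow> s \<in> S \<Longrightarrow> P (w \<otimes> s)"
  shows "P w"
proof -
  obtain ws where ws: "ws \<in> lists S" "val ws = w" using val_surj assms(1) by blast
  have "P (val ws)" using ws(1)
    by (induction ws rule: rev_induct) (auto simp: assms(2) val_append intro: step)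
  then show ?thesis using ws by simp
qed

text \<open>The universal property of the presentation, for right actions on a set.\<close>

lemma orbit_map:
  fixes A :: "'a \<Rightarrow> 'x \<Rightarrow> 'x"
  assumes closed: "\<And>s x. s \<in> S \<Longrightarrow> x \<in> X \<Longrightarrow> A s x \<in> X"
    and invol: "\<And>s x. s \<in> S \<Longrightarrow> x \<in> X \<Longrightarrow> A s (A s x) = x"
    and braid: "\<And>s t n x. s \<in> S \<Longrightarrow> t \<in> S \<Longrightarrow> s \<noteq> t \<Longrightarrow> coxeter_order W s t = enat n \<Longrightarrow> x \<in> X
                  \<Longrightarrow> ((\<lambda>x. A t (A s x)) ^^ n) x = x"
    and x0: "x0 \<in> X"
  shows "\<exists>h. h \<one> = x0 \<and> (\<forall>w\<in>carrier W. h w \<in> X) \<and>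
             (\<forall>w\<in>carrier W. \<forall>s\<in>S. h (w \<otimes> s) = A s (h w))"
proof -
  \<comment> \<open>\<open>presentation_eq\<close> puts no condition on the letters of the
    surrounding words, so the action is made total, with the identity as default off
    \<open>S\<close> and off \<open>X\<close>.\<close>
  define B where "B = (\<lambda>s x. if s \<in> S \<and> x \<in> X then A s x else x)"
  \<comment> \<open>Signs are ignored since each letter acts as an involution; \<open>fold\<close>
    lets the first letter act first, which gives a right action.\<close>
  define act :: "'a signed_word \<Rightarrow> 'x \<Rightarrow> 'x" where "act = fold (\<lambda>l. B (snd l))"
  have act_append: "act (u @ v) x = act v (act u x)" for u v x
    by (simp add: act_def)
  have BX: "B s x \<in> X" if "x \<in> X" for s x
    using that closed by (auto simp: B_def)
  have BB: "B s (B s x) = x" for s x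
    using closed invol by (auto simp: B_def)
  have relators: "act r x = x" if r: "r \<in> coxeter_relators W S" for r x
  proof -
    from r consider s where "s \<in> S" "r = [(True, s), (True, s)]"
      | s t n where "s \<in> S" "t \<in> S" "s \<noteq> t" "coxeter_order W s t = enat n"
          "r = concat (replicate n [(True, s), (True, t)])"
      by (auto simp: coxeter_relators_def)
    then show ?thesis
    proof cases
      case 1
      then show ?thesis by (simp add: act_def BB)
    next
      case 2
      have pow: "act (concat (replicate k [(True, s), (True, t)])) x = ((\<lambda>x. B t (B s x)) ^^ k) x"
        for k x
        by (induction k arbitrary: x) (simp_all add: act_def funpow_Suc_right del: funpow.simps(2))
      have "((\<lambda>x. B t (B s x)) ^^ k) x = ((\<lambda>x. A t (A s x)) ^^ k) x \<and>
              ((\<lambda>x. A t (A s x)) ^^ k) x \<in> X" if "x \<in> X" for k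
        using 2 that closed by (induction k) (auto simp: B_def)
      moreover have "((\<lambda>x. B t (B s x)) ^^ k) x = x" if "x \<notin> X" for k
        using that by (induction k) (auto simp: B_def)
      ultimately show ?thesis using 2 pow braid by (cases "x \<in> X") auto
    qed
  qed
  have act_eq: "act u x = act v x" if "presentation_eq S (coxeter_relators W S) u v" for u v x
    using that
    by (induction arbitrary: x) (auto simp: act_append relators, simp add: act_def BB)
  define fa where "fa ws = act (map (Pair True) ws)" for ws
  have fa_simps [simp]: "fa [] x = x" "fa (s # ws) x = fa ws (B s x)" "fa (us @ ws) x = fa ws (fa us x)"
    for s us ws x
    by (simp_all add: fa_def act_def)
  have fa_rev: "fa (rev ws) (fa ws x) = x" for ws x
    by (induction ws arbitrary: x) (simp_all add: BB)
  have faX: "fa ws x \<in> X" if "x \<in> X" for ws x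
    using that by (induction ws arbitrary: x) (simp_all add: BX)
  \<comment> \<open>The word \<open>u @ rev v\<close> has value \<open>\<one>\<close>, hence is
    trivial in the presentation and acts trivially; so the action depends only on the value of a
    word.\<close>
  have fa_eq: "fa u x = fa v x"
    if uv: "u \<in> lists S" "v \<in> lists S" "val u = val v" for u v x
  proof -
    have "word_value W (map (Pair True) (u @ rev v)) = \<one>"
      unfolding word_value_unsigned using uv by (simp add: val_append val_rev)
    moreover have "map (Pair True) (u @ rev v) \<in> signed_words S"
      using uv by (auto simp: signed_words_def)
    ultimately have "presentation_eq S (coxeter_relators W S) (map (Pair True) (u @ rev v)) []"
      using has_presentation by (simp add: has_presentation_def)
    from act_eq[OF this] have "fa (u @ rev v) x = x"
      by (simp add: fa_def act_def)
    then have "fa v x = fa v (fa (rev v) (fa u x))" by simp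
    also have "\<dots> = fa u x" using fa_rev[of "rev v" "fa u x"] by simp
    finally show ?thesis by simp
  qed
  define wd where "wd w = (SOME ws. ws \<in> lists S \<and> val ws = w)" for w
  have wd: "wd w \<in> lists S" "val (wd w) = w" if "w \<in> carrier W" for w
    using someI_ex[of "\<lambda>ws. ws \<in> lists S \<and> val ws = w"] that val_surj unfolding wd_def by metis+
  define h where "h w = fa (wd w) x0" for w
  have "h \<one> = x0"
    using fa_eq[of "wd \<one>" "[]" x0] wd[of \<one>] by (simp add: h_def)
  moreover have "h w \<in> X" for w by (simp add: h_def faX x0)
  moreover have "h (w \<otimes> s) = A s (h w)" if "w \<in> carrier W" "s \<in> S" for w s
  proof -
    have "h (w \<otimes> s) = fa (wd w @ [s]) x0"
      unfolding h_def using that wd[of w] wd[of "w \<otimes> s"]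
      by (intro fa_eq) (auto simp: val_append)
    also have "\<dots> = B s (h w)" by (simp add: h_def)
    finally show ?thesis using that \<open>h w \<in> X\<close> by (simp add: B_def)
  qed
  ultimately show ?thesis by blast
qed

subsection \<open>Reflections, length and the exchange condition\<close>

text \<open>Conjugation by the reflection \<open>s\<close> inverts the rotation
  \<open>s \<otimes> t\<close>.\<close>

lemma dihedral_flip:
  assumes "s \<in> S" "t \<in> S"
  shows "s \<otimes> inv ((s \<otimes> t) [^] (k::nat)) = (s \<otimes> t) [^] k \<otimes> s"
proof (induction k)
  case 0
  then show ?case using assms by simp
next
  case (Suc k)
  have "s \<otimes> inv ((s \<otimes> t) [^] Suc k) = s \<otimes> t \<otimes> (s \<otimes> inv ((s \<otimes> t) [^] k))"
    using assms by (simp add: inv_mult_group m_assoc)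
  also have "\<dots> = s \<otimes> t \<otimes> (s \<otimes> t) [^] k \<otimes> s"
    using assms by (simp add: Suc m_assoc)
  also have "\<dots> = (s \<otimes> t) [^] Suc k \<otimes> s"
    using assms by (subst nat_pow_Suc2) auto
  finally show ?case .
qed

text \<open>
  The sign of \<open>r\<close> at \<open>w\<close> is \<open>-1\<close> iff the wall of the reflection \<open>r\<close> separates \<open>w\<close> from \<open>\<one>\<close>.
\<close>

lemma reflection_sign_exists:
  "\<exists>e :: 'a \<Rightarrow> int. e \<one> = 1 \<and>
     (\<forall>w\<in>carrier W. \<forall>s\<in>S. e (w \<otimes> s) = e w * (if w \<otimes> s \<otimes> inv w = r then -1 else 1))"
proof -
  define c :: "'a \<Rightarrow> int" where "c q = (if q = r then -1 else 1)" for q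
  \<comment> \<open>A state is a vertex with a sign. Walking along the edge from \<open>w\<close> to
    \<open>w \<otimes> u\<close> crosses the wall of the reflection
    \<open>w \<otimes> u \<otimes> inv w\<close>, and the sign flips when this is
    \<open>r\<close>.\<close>
  define A where "A u p = (fst p \<otimes> u, snd p * c (fst p \<otimes> u \<otimes> inv (fst p)))" for u p
  have cc [simp]: "c q * c q = 1" for q by (simp add: c_def)
  have "\<exists>h. h \<one> = (\<one>, 1) \<and> (\<forall>w\<in>carrier W. h w \<in> carrier W \<times> UNIV) \<and>
             (\<forall>w\<in>carrier W. \<forall>s\<in>S. h (w \<otimes> s) = A s (h w))"
  proof (rule orbit_map)
    fix s p assume "s \<in> S" "p \<in> carrier W \<times> (UNIV :: int set)"
    then show "A s (A s p) = p"
      by (auto simp: A_def inv_mult_group m_assoc)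
  next
    fix s t n and p :: "'a \<times> int"
    assume st: "s \<in> S" "t \<in> S" "s \<noteq> t" "coxeter_order W s t = enat n"
      and p: "p \<in> carrier W \<times> UNIV"
    obtain w a where [simp]: "p = (w, a)" by (cases p)
    have w [simp]: "w \<in> carrier W" using p by simp
    have [simp]: "s \<in> carrier W" "t \<in> carrier W" using st by auto
    define d where "d = s \<otimes> t"
    have d [simp]: "d \<in> carrier W" by (simp add: d_def)
    \<comment> \<open>\<open>q j\<close> is the reflection whose wall is crossed at step
      \<open>j\<close> of the walk from \<open>w\<close> along s, t, s, t, ...\<close>
    define q where "q j = w \<otimes> (d [^] (j::nat) \<otimes> s) \<otimes> inv w" for j
    have iter: "((\<lambda>x. A t (A s x)) ^^ k) p = (w \<otimes> d [^] k, a * (\<Prod>j<2*k. c (q j)))" for k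
    proof (induction k)
      case 0
      then show ?case by simp
    next
      case (Suc k)
      have flip: "s \<otimes> inv (d [^] k) = d [^] k \<otimes> s"
        using dihedral_flip[of s t k] st by (simp add: d_def)
      have "w \<otimes> d [^] k \<otimes> s \<otimes> inv (w \<otimes> d [^] k) = w \<otimes> d [^] k \<otimes> (s \<otimes> inv (d [^] k)) \<otimes> inv w"
        by (simp add: inv_mult_group m_assoc)
      also have "\<dots> = q (2 * k)"
        by (simp add: flip q_def mult_2 m_assoc flip: nat_pow_mult)
      finally have q1: "w \<otimes> d [^] k \<otimes> s \<otimes> inv (w \<otimes> d [^] k) = q (2 * k)" .
      have "w \<otimes> d [^] k \<otimes> s \<otimes> t \<otimes> inv (w \<otimes> d [^] k \<otimes> s) =
              w \<otimes> d [^] k \<otimes> d \<otimes> (s \<otimes> inv (d [^] k)) \<otimes> inv w"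
        using st by (simp add: inv_mult_group m_assoc d_def)
      also have "\<dots> = w \<otimes> (d [^] k \<otimes> d \<otimes> d [^] k \<otimes> s) \<otimes> inv w"
        by (simp add: flip m_assoc)
      also have "d [^] k \<otimes> d \<otimes> d [^] k = d [^] Suc (2 * k)"
        using nat_pow_mult[of d "Suc k" k] by (simp add: mult_2)
      finally have q2: "w \<otimes> d [^] k \<otimes> s \<otimes> t \<otimes> inv (w \<otimes> d [^] k \<otimes> s) = q (Suc (2 * k))"
        by (simp only: q_def)
      have "((\<lambda>x. A t (A s x)) ^^ Suc k) p =
              (w \<otimes> d [^] k \<otimes> s \<otimes> t, a * (\<Prod>j<2*k. c (q j)) * c (q (2 * k)) * c (q (Suc (2 * k))))"
        by (simp only: funpow.simps comp_apply Suc) (simp add: A_def q1 q2)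
      also have "w \<otimes> d [^] k \<otimes> s \<otimes> t = w \<otimes> d [^] Suc k"
        by (simp add: d_def m_assoc)
      finally show ?case by (simp add: mult.assoc)
    qed
    have dn: "d [^] n = \<one>"
      using st pow_ord_eq_1[OF d] by (simp add: coxeter_order_enat d_def)
    \<comment> \<open>The walk around the 2n-cycle meets the same walls in its second half as in its
      first, so every sign change occurs an even number of times.\<close>
    have "q (n + j) = q j" for j
      by (simp add: q_def dn flip: nat_pow_mult)
    then have "(\<Prod>j<n+k. c (q j)) = (\<Prod>j<n. c (q j)) * (\<Prod>j<k. c (q j))" for k
      by (induction k) simp_all
    then have "(\<Prod>j<n+n. c (q j)) = (\<Prod>j<n. c (q j)) * (\<Prod>j<n. c (q j))" .
    also have "\<dots> = 1" by (simp flip: prod.distrib)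
    finally show "((\<lambda>x. A t (A s x)) ^^ n) p = p"
      using iter[of n] by (simp add: dn mult_2)
  qed (auto simp: A_def)
  then obtain h where h: "h \<one> = (\<one>, 1)"
      "\<And>w s. w \<in> carrier W \<Longrightarrow> s \<in> S \<Longrightarrow> h (w \<otimes> s) = A s (h w)" by blast
  have "fst (h w) = w" if "w \<in> carrier W" for w
    using that by (induction rule: generator_induct) (auto simp: h A_def)
  then show ?thesis
    using h by (intro exI[of _ "snd \<circ> h"]) (auto simp: A_def c_def)
qed

definition reflection_sign :: "'a \<Rightarrow> 'a \<Rightarrow> int" where
  "reflection_sign r = (SOME e. e \<one> = 1 \<and>
     (\<forall>w\<in>carrier W. \<forall>s\<in>S. e (w \<otimes> s) = e w * (if w \<otimes> s \<otimes> inv w = r then -1 else 1)))"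

lemma reflection_sign_one [simp]: "reflection_sign r \<one> = 1"
  and reflection_sign_step: "w \<in> carrier W \<Longrightarrow> s \<in> S \<Longrightarrow>
    reflection_sign r (w \<otimes> s) = reflection_sign r w * (if w \<otimes> s \<otimes> inv w = r then -1 else 1)"
  using someI_ex[OF reflection_sign_exists[of r]] unfolding reflection_sign_def by blast+

lemma reflection_sign_cases:
  "w \<in> carrier W \<Longrightarrow> reflection_sign r w = 1 \<or> reflection_sign r w = -1"
  by (induction rule: generator_induct) (auto simp: reflection_sign_step)

text \<open>A path from \<open>\<one>\<close> to \<open>w\<close>, translated by \<open>s\<close>,
  crosses the wall of \<open>s\<close> exactly when the original does, because conjugation by
  \<open>s\<close> fixes \<open>s\<close>. The extra first edge from \<open>\<one>\<close> to
  \<open>s\<close> crosses it once more.\<close>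

lemma reflection_sign_generator_mult:
  assumes "s \<in> S" "w \<in> carrier W"
  shows "reflection_sign s (s \<otimes> w) = - reflection_sign s w"
  using assms(2)
proof (induction rule: generator_induct)
  case one
  show ?case using assms(1) reflection_sign_step[of \<one> s s] by simp
next
  case (step w u)
  have "s \<otimes> w \<otimes> u \<otimes> inv (s \<otimes> w) = s \<otimes> (w \<otimes> u \<otimes> inv w) \<otimes> s"
    using step assms by (simp add: inv_mult_group m_assoc)
  moreover have "s \<otimes> x \<otimes> s = s \<longleftrightarrow> x = s" if "x \<in> carrier W" for x
    using that assms(1) by (metis generator_cancel_left generator_cancel_right generator_closed m_closed)
  ultimately have "s \<otimes> w \<otimes> u \<otimes> inv (s \<otimes> w) = s \<longleftrightarrow> w \<otimes> u \<otimes> inv w = s"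
    using step by simp
  moreover have "s \<otimes> (w \<otimes> u) = s \<otimes> w \<otimes> u"
    using step assms by (simp add: m_assoc)
  ultimately show ?case
    using step assms by (simp add: reflection_sign_step)
qed

text \<open>The sign starts at 1, so some letter of the word must cross the wall of
  \<open>r\<close>.\<close>

lemma reflection_sign_val:
  assumes "ws \<in> lists S" "reflection_sign r (val ws) = -1"
  shows "\<exists>i<length ws. r = val (take i ws) \<otimes> ws ! i \<otimes> inv (val (take i ws))"
  using assms
proof (induction ws rule: rev_induct)
  case Nil
  then show ?case by simp
next
  case (snoc a ws)
  show ?case
  proof (cases "val ws \<otimes> a \<otimes> inv (val ws) = r")
    case True
    then show ?thesis by (intro exI[of _ "length ws"]) auto
  next
    case False
    then have "reflection_sign r (val ws) = -1"
      using snoc.prems by (simp add: val_append reflection_sign_step)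
    then obtain i where "i < length ws" "r = val (take i ws) \<otimes> ws ! i \<otimes> inv (val (take i ws))"
      using snoc by auto
    then show ?thesis by (intro exI[of _ i]) (auto simp: nth_append)
  qed
qed

section \<open>Word length, deletion and exchange\<close>

definition word_length :: "'a \<Rightarrow> nat" where
  "word_length w = (LEAST n. \<exists>ws \<in> lists S. length ws = n \<and> val ws = w)"

lemma word_length_le: "ws \<in> lists S \<Longrightarrow> word_length (val ws) \<le> length ws"
  unfolding word_length_def by (rule Least_le) blast

lemma reduced_word:
  assumes "w \<in> carrier W"
  obtains ws where "ws \<in> lists S" "val ws = w" "length ws = word_length w"
proof -
  obtain vs where "vs \<in> lists S" "val vs = w" using val_surj assms by blast
  then have "\<exists>n. \<exists>ws \<in> lists S. length ws = n \<and> val ws = w" by blast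
  from LeastI_ex[OF this] show thesis using that unfolding word_length_def by blast
qed

lemma word_length_one [simp]: "word_length \<one> = 0"
  using word_length_le[of "[]"] by simp

text \<open>By the last hypothesis the prefix of length \<open>Suc i\<close> can be replaced by
  \<open>s\<close> followed by the prefix of length \<open>i\<close>, and then the two copies of
  \<open>s\<close> cancel.\<close>

lemma deletion:
  assumes "s \<in> S" "ws \<in> lists S" "i < length ws" "s \<otimes> val (take i ws) = val (take (Suc i) ws)"
  shows "s \<otimes> val ws = val (take i ws @ drop (Suc i) ws)"
proof -
  have in_S: "take n ws \<in> lists S" "drop n ws \<in> lists S" for n
    using assms(2) by (auto dest: in_set_takeD in_set_dropD)
  have "val ws = val (take (Suc i) ws) \<otimes> val (drop (Suc i) ws)"
    using val_append[OF in_S, of "Suc i" "Suc i"] by simp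
  also have "\<dots> = s \<otimes> val (take i ws @ drop (Suc i) ws)"
    using in_S assms(1) by (subst val_append) (auto simp flip: assms(4) simp: m_assoc in_S val_closed)
  finally show ?thesis
    using in_S(1)[of i] in_S(2)[of "Suc i"] assms(1)
    by (metis append_in_lists_conv generator_cancel_left val_closed)
qed

lemma exchange_sign:
  assumes "s \<in> S" "ws \<in> lists S" "reflection_sign s (val ws) = -1"
  shows "\<exists>i<length ws. s \<otimes> val (take i ws) = val (take (Suc i) ws)"
proof -
  obtain i where i: "i < length ws" "s = val (take i ws) \<otimes> ws ! i \<otimes> inv (val (take i ws))"
    using reflection_sign_val assms by blast
  have c: "take i ws \<in> lists S" "ws ! i \<in> S" using assms(2) i by (auto dest: in_set_takeD)
  have "s \<otimes> val (take i ws) = val (take i ws) \<otimes> ws ! i"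
    by (subst i(2)) (use c in \<open>auto simp: m_assoc val_closed generator_closed simp del: in_lists_conv_set\<close>)
  also have "\<dots> = val (take (Suc i) ws)"
    using i c by (simp add: take_Suc_conv_app_nth val_append)
  finally show ?thesis using i by blast
qed

lemma sign_descent:
  assumes "s \<in> S" "w \<in> carrier W" "reflection_sign s w = -1"
  shows "word_length (s \<otimes> w) < word_length w"
proof -
  obtain ws where ws: "ws \<in> lists S" "val ws = w" "length ws = word_length w"
    using reduced_word assms by blast
  obtain i where i: "i < length ws" "s \<otimes> val (take i ws) = val (take (Suc i) ws)"
    using exchange_sign assms ws by blast
  have "take i ws @ drop (Suc i) ws \<in> lists S"
    using ws by (auto dest: in_set_takeD in_set_dropD)
  from word_length_le[OF this] show ?thesis
    using deletion[OF assms(1) ws(1) i] ws i by simp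
qed

text \<open>Exactly one of \<open>w\<close> and \<open>s \<otimes> w\<close> has sign -1 at
  \<open>s\<close>, and \<open>sign_descent\<close> shows that one to be the longer.\<close>

lemma descent_iff:
  assumes "s \<in> S" "w \<in> carrier W"
  shows "word_length (s \<otimes> w) < word_length w \<longleftrightarrow> reflection_sign s w = -1"
proof
  assume less: "word_length (s \<otimes> w) < word_length w"
  show "reflection_sign s w = -1"
  proof (rule ccontr)
    assume "reflection_sign s w \<noteq> -1"
    then have "reflection_sign s (s \<otimes> w) = -1"
      using reflection_sign_cases[OF assms(2)] reflection_sign_generator_mult[OF assms] by auto
    then have "word_length (s \<otimes> (s \<otimes> w)) < word_length (s \<otimes> w)"
      using sign_descent[of s "s \<otimes> w"] assms by simp
    then show False using less assms by simp
  qed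
qed (use sign_descent assms in blast)

lemma exchange:
  assumes "s \<in> S" "ws \<in> lists S" "word_length (s \<otimes> val ws) < word_length (val ws)"
  shows "\<exists>i<length ws. s \<otimes> val (take i ws) = val (take (Suc i) ws)"
  using assms exchange_sign descent_iff by blast

lemma word_length_generator_mult_le:
  assumes "s \<in> S" "w \<in> carrier W"
  shows "word_length (s \<otimes> w) \<le> Suc (word_length w)"
proof -
  obtain ws where "ws \<in> lists S" "val ws = w" "length ws = word_length w"
    using reduced_word assms by blast
  then show ?thesis using word_length_le[of "s # ws"] assms by simp
qed

lemma word_length_ascent:
  assumes "s \<in> S" "w \<in> carrier W" "\<not> word_length (s \<otimes> w) < word_length w"
  shows "word_length (s \<otimes> w) = Suc (word_length w)"
proof -
  have "reflection_sign s (s \<otimes> w) = -1"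
    using assms reflection_sign_cases[OF assms(2)] reflection_sign_generator_mult[OF assms(1,2)]
    by (auto simp: descent_iff)
  then have "word_length w < word_length (s \<otimes> w)"
    using sign_descent[of s "s \<otimes> w"] assms by simp
  then show ?thesis using word_length_generator_mult_le[OF assms(1,2)] by simp
qed

lemma word_length_generator [simp]:
  assumes "s \<in> S" shows "word_length s = 1"
  using word_length_ascent[of s \<one>] assms by simp

text \<open>Prepending a letter of \<open>J\<close> to a reduced \<open>J\<close>-word either keeps
  it reduced or, by exchange, amounts to deleting one of its letters; neither leaves
  \<open>J\<close>.\<close>

lemma parabolic_reduced_word:
  assumes "J \<subseteq> S" "ws \<in> lists J"
  shows "\<exists>vs \<in> lists J. val vs = val ws \<and> length vs = word_length (val ws)"
  using assms(2)
proof (induction ws)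
  case Nil
  then show ?case by (intro bexI[of _ "[]"]) auto
next
  case (Cons u ws)
  then obtain vs where vs: "vs \<in> lists J" "val vs = val ws" "length vs = word_length (val ws)"
    by auto
  have u: "u \<in> S" "u \<in> J" and S: "ws \<in> lists S" "vs \<in> lists S" using Cons vs assms(1) by auto
  show ?case
  proof (cases "word_length (u \<otimes> val ws) < word_length (val ws)")
    case True
    then obtain i where i: "i < length vs" "u \<otimes> val (take i vs) = val (take (Suc i) vs)"
      using exchange[OF u(1) S(2)] vs by auto
    let ?xs = "take i vs @ drop (Suc i) vs"
    have "val ?xs = u \<otimes> val ws" using deletion[OF u(1) S(2) i] vs by simp
    moreover have "?xs \<in> lists J" using vs by (auto dest: in_set_takeD in_set_dropD)
    moreover have "length ?xs \<le> word_length (u \<otimes> val ws)"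
      using i vs word_length_generator_mult_le[of u "u \<otimes> val ws"] u S
      by (simp add: val_closed)
    moreover have "word_length (val ?xs) \<le> length ?xs"
      using S by (intro word_length_le) (auto dest: in_set_takeD in_set_dropD)
    ultimately show ?thesis by (intro bexI[of _ ?xs]) auto
  next
    case False
    then show ?thesis
      using word_length_ascent[of u "val ws"] u S vs by (intro bexI[of _ "u # vs"]) auto
  qed
qed

lemma generator_in_parabolic:
  assumes "J \<subseteq> S" "ws \<in> lists J" "val ws \<in> S"
  shows "val ws \<in> J"
proof -
  obtain vs where vs: "vs \<in> lists J" "val vs = val ws" "length vs = 1"
    using parabolic_reduced_word[OF assms(1,2)] assms(3) by auto
  then obtain v where "vs = [v]" by (auto simp: length_Suc_conv)
  then show ?thesis using vs assms(1) by auto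
qed

subsection \<open>Alternating words\<close>

fun alt :: "'a \<Rightarrow> 'a \<Rightarrow> nat \<Rightarrow> 'a list" where
  "alt s t 0 = []"
| "alt s t (Suc k) = s # alt t s k"

lemma length_alt [simp]: "length (alt s t k) = k"
  by (induction s t k rule: alt.induct) auto

lemma set_alt: "set (alt s t k) \<subseteq> {s, t}"
  by (induction s t k rule: alt.induct) auto

lemma alt_in_lists: "s \<in> S \<Longrightarrow> t \<in> S \<Longrightarrow> alt s t k \<in> lists S"
  using set_alt[of s t k] by auto

lemma take_alt: "i \<le> k \<Longrightarrow> take i (alt s t k) = alt s t i"
  by (induction s t k arbitrary: i rule: alt.induct) (auto simp: take_Cons split: nat.split)

text \<open>The two words start at opposite sides of the dihedral cycle and differ by a rotation;
  the induction moves \<open>s\<close> past a power of \<open>t \<otimes> s\<close>, turning it into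
  a power of \<open>s \<otimes> t\<close>.\<close>

lemma val_alt_swap:
  assumes "s \<in> S" "t \<in> S"
  shows "val (alt s t k) = (s \<otimes> t) [^] k \<otimes> val (alt t s k)"
  using assms
proof (induction s t k rule: alt.induct)
  case (2 s t k)
  have [simp]: "val (alt s t j) \<in> carrier W" "val (alt t s j) \<in> carrier W" for j
    using 2 alt_in_lists by (blast intro: val_closed)+
  have [simp]: "s \<in> carrier W" "t \<in> carrier W" using 2 by auto
  have shift: "s \<otimes> (t \<otimes> s) [^] j = (s \<otimes> t) [^] j \<otimes> s" for j :: nat
  proof (induction j)
    case (Suc j)
    have "s \<otimes> (t \<otimes> s) [^] Suc j = s \<otimes> (t \<otimes> s) [^] j \<otimes> (t \<otimes> s)" by (simp add: m_assoc)
    also have "\<dots> = (s \<otimes> t) [^] Suc j \<otimes> s" by (simp only: Suc) (simp add: m_assoc)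
    finally show ?case .
  qed simp
  have "val (alt s t (Suc k)) = s \<otimes> (t \<otimes> s) [^] k \<otimes> val (alt s t k)"
    using 2(1)[OF 2(3,2)] by (simp add: m_assoc)
  also have "\<dots> = (s \<otimes> t) [^] Suc k \<otimes> val (alt t s (Suc k))"
    by (simp only: shift) (use 2(2,3) in \<open>simp add: m_assoc\<close>)
  finally show ?case .
qed simp

lemma val_alt_eq_iff:
  assumes "s \<in> S" "t \<in> S"
  shows "val (alt s t k) = val (alt t s k) \<longleftrightarrow> (s \<otimes> t) [^] k = \<one>"
proof -
  have "val (alt t s k) \<in> carrier W" "(s \<otimes> t) [^] k \<in> carrier W"
    using assms alt_in_lists by (auto intro!: val_closed simp del: in_lists_conv_set)
  then show ?thesis unfolding val_alt_swap[OF assms]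
    by simp
qed

lemma val_alt_eq_order:
  assumes "s \<in> S" "t \<in> S" "coxeter_order W s t = enat n"
  shows "val (alt s t k) = val (alt t s k) \<longleftrightarrow> n dvd k"
  using assms by (auto simp: val_alt_eq_iff coxeter_order_enat pow_eq_id)

lemma val_alt_neq:
  assumes "s \<in> S" "t \<in> S" "enat k < coxeter_order W s t" "0 < k"
  shows "val (alt s t k) \<noteq> val (alt t s k)"
proof (cases "coxeter_order W s t")
  case (enat n)
  then show ?thesis using assms val_alt_eq_order[of s t n k] by (auto dest: dvd_imp_le)
next
  case infinity
  then have "ord (s \<otimes> t) = 0" by (auto simp: coxeter_order_def split: if_splits)
  then show ?thesis using assms by (simp add: val_alt_eq_iff pow_eq_id)
qed

text \<open>Induction with \<open>s\<close> and \<open>t\<close> exchanged: a reduced word of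
  \<open>y\<close> starting with \<open>alt t s k\<close> loses a letter under left multiplication
  by \<open>s\<close>. That letter lies behind the prefix, so \<open>s\<close> can be put in front
  of it.\<close>

lemma two_descents_prefix:
  assumes "s \<in> S" "t \<in> S" "y \<in> carrier W"
    and "word_length (s \<otimes> y) < word_length y" "word_length (t \<otimes> y) < word_length y"
    and "\<And>j. 0 < j \<Longrightarrow> j < k \<Longrightarrow> val (alt s t j) \<noteq> val (alt t s j)"
  shows "\<exists>zs \<in> lists S. y = val (alt s t k @ zs) \<and> k + length zs = word_length y"
  using assms
proof (induction s t k rule: alt.induct)
  case (1 s t)
  then obtain zs where "zs \<in> lists S" "val zs = y" "length zs = word_length y"
    using reduced_word by blast
  then show ?case by (intro bexI[of _ zs]) auto
next
  case (2 s t k)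
  have "val (alt t s j) \<noteq> val (alt s t j)" if "0 < j" "j < k" for j
    using 2(7)[of j] that by simp
  from 2(1)[OF 2(3,2,4,6,5) this] obtain zs
    where zs: "zs \<in> lists S" "y = val (alt t s k @ zs)" "k + length zs = word_length y"
    by blast
  let ?ws = "alt t s k @ zs"
  have ws: "?ws \<in> lists S" using alt_in_lists[of t s k] zs 2 by auto
  obtain i where i: "i < length ?ws" "s \<otimes> val (take i ?ws) = val (take (Suc i) ?ws)"
    using exchange[OF 2(2) ws] 2(5) zs(2) by blast
  \<comment> \<open>A deletion inside the prefix would equate the two alternating words of length
    \<open>Suc i\<close>, which is at most \<open>k\<close> and so below
    \<open>Suc k\<close>.\<close>
  have "k \<le> i"
  proof (rule ccontr)
    assume "\<not> k \<le> i"
    then have "val (alt s t (Suc i)) = val (alt t s (Suc i))"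
      using i(2) take_alt[of i k t s] take_alt[of "Suc i" k t s] by simp
    then show False using 2(7)[of "Suc i"] \<open>\<not> k \<le> i\<close> by simp
  qed
  define xs where "xs = take (i - k) zs @ drop (Suc i - k) zs"
  have xs: "xs \<in> lists S" using zs by (auto simp: xs_def dest: in_set_takeD in_set_dropD)
  have "s \<otimes> y = val (alt t s k @ xs)"
    using deletion[OF 2(2) ws i] \<open>k \<le> i\<close> zs by (simp add: xs_def)
  then have "y = s \<otimes> val (alt t s k @ xs)"
    using generator_cancel_left[OF 2(2,4)] by simp
  moreover have "Suc k + length xs = word_length y"
    using i \<open>k \<le> i\<close> zs by (simp add: xs_def)
  ultimately show ?case using xs by (intro bexI[of _ xs]) auto
qed

text \<open>Every alternating prefix up to length m_st fits into a reduced word of \<open>y\<close>.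
  If m_st were infinite, a prefix longer than \<open>y\<close> would fit; if the full length is used
  up, nothing follows the prefix.\<close>

lemma two_descents:
  assumes "s \<in> S" "t \<in> S" "s \<noteq> t" "y \<in> carrier W"
    and "word_length (s \<otimes> y) < word_length y" "word_length (t \<otimes> y) < word_length y"
  obtains n where "coxeter_order W s t = enat n" "n \<le> word_length y"
    "word_length y = n \<Longrightarrow> y = val (alt s t n)"
proof -
  have prefix: "\<exists>zs \<in> lists S. y = val (alt s t k @ zs) \<and> k + length zs = word_length y"
    if "enat k \<le> coxeter_order W s t" for k
  proof (rule two_descents_prefix[OF assms(1,2,4-6)])
    fix j assume "0 < j" "j < k"
    then show "val (alt s t j) \<noteq> val (alt t s j)"
      using that assms by (intro val_alt_neq) (auto intro: less_le_trans[of _ "enat k"])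
  qed
  have "coxeter_order W s t \<noteq> \<infinity>"
  proof
    assume "coxeter_order W s t = \<infinity>"
    then show False using prefix[of "Suc (word_length y)"] by simp
  qed
  then obtain n where n: "coxeter_order W s t = enat n" by auto
  with prefix[of n] obtain zs where "y = val (alt s t n @ zs)" "n + length zs = word_length y"
    by auto
  then show thesis using n by (intro that[of n]) auto
qed

text \<open>If prepending \<open>s\<close> shortened \<open>alt t s k\<close>, exchange would make
  two alternating words of some positive length below m_st equal.\<close>

lemma word_length_alt:
  assumes "s \<in> S" "t \<in> S" "s \<noteq> t" "enat k \<le> coxeter_order W s t"
  shows "word_length (val (alt s t k)) = k"
  using assms
proof (induction s t k rule: alt.induct)
  case (2 s t k)
  have ws: "alt t s k \<in> lists S" using alt_in_lists 2 by blast
  have "coxeter_order W t s = coxeter_order W s t"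
    using coxeter_order_commute[OF coxeter_system] 2 by blast
  moreover have "enat k \<le> coxeter_order W s t"
    using 2(5) by (rule order_trans[rotated]) simp
  ultimately have IH: "word_length (val (alt t s k)) = k" using 2 by simp
  have "\<not> word_length (s \<otimes> val (alt t s k)) < word_length (val (alt t s k))"
  proof
    assume "word_length (s \<otimes> val (alt t s k)) < word_length (val (alt t s k))"
    then obtain i where i: "i < k" "s \<otimes> val (take i (alt t s k)) = val (take (Suc i) (alt t s k))"
      using exchange[of s "alt t s k"] ws 2 by auto
    then have "val (alt s t (Suc i)) = val (alt t s (Suc i))"
      using take_alt[of i k t s] take_alt[of "Suc i" k t s] by (simp del: take_Suc_Cons)
    moreover have "enat (Suc i) < coxeter_order W s t"
      using i 2(5) by (auto intro: less_le_trans[of _ "enat (Suc k)"])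
    ultimately show False using val_alt_neq 2 by blast
  qed
  then show ?case using word_length_ascent[of s "val (alt t s k)"] ws 2 IH by auto
qed simp

text \<open>Exchange writes \<open>r\<close> as a word in \<open>s\<close> and \<open>t\<close>, so
  \<open>r\<close> is one of them. If it were \<open>t\<close>, both would be descents and
  \<open>two_descents\<close> would force m_st to be at most \<open>k\<close>.\<close>

lemma alt_unique_descent:
  assumes "s \<in> S" "t \<in> S" "r \<in> S" "s \<noteq> t" "enat k < coxeter_order W s t"
    and desc: "word_length (r \<otimes> val (alt s t k)) < word_length (val (alt s t k))"
  shows "r = s"
proof (rule ccontr)
  assume "r \<noteq> s"
  let ?y = "val (alt s t k)"
  have ws: "alt s t k \<in> lists S" and y: "?y \<in> carrier W" using alt_in_lists assms by blast+
  have len: "word_length ?y = k" using assms by (intro word_length_alt) auto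
  obtain i where i: "i < k" "r \<otimes> val (take i (alt s t k)) = val (take (Suc i) (alt s t k))"
    using exchange[OF assms(3) ws desc] by auto
  then have "r \<otimes> val (alt s t i) = val (alt s t (Suc i))"
    by (metis Suc_leI less_imp_le take_alt)
  moreover have "alt s t j \<in> lists S" for j using alt_in_lists assms by blast
  ultimately have "r = val (alt s t (Suc i)) \<otimes> inv (val (alt s t i))"
    using inv_solve_right[of r "val (alt s t (Suc i))" "val (alt s t i)"] assms(3) val_closed generator_closed
    by presburger
  also have "\<dots> = val (alt s t (Suc i) @ rev (alt s t i))"
    using \<open>\<And>j. alt s t j \<in> lists S\<close> by (subst val_append) (auto simp: val_rev simp del: alt.simps)
  finally have r: "r = val (alt s t (Suc i) @ rev (alt s t i))" .
  have "alt s t (Suc i) @ rev (alt s t i) \<in> lists {s, t}"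
    using set_alt[of s t "Suc i"] set_alt[of s t i] by auto
  from generator_in_parabolic[OF _ this] have "r \<in> {s, t}"
    using assms(1-3) unfolding r by blast
  with \<open>r \<noteq> s\<close> have "r = t" by blast
  have "0 < k" using i by simp
  then obtain k' where k': "k = Suc k'" by (cases k) auto
  have "alt t s k' \<in> lists S" using alt_in_lists assms by blast
  then have "word_length (s \<otimes> ?y) \<le> k'"
    using word_length_le[of "alt t s k'"] assms unfolding k' by (simp add: val_closed)
  then have "word_length (s \<otimes> ?y) < word_length ?y" using len k' by simp
  then obtain n where "coxeter_order W s t = enat n" "n \<le> word_length ?y"
    using two_descents[OF assms(1,2,4) y] desc \<open>r = t\<close> by metis
  then show False using assms(5) len by simp
qed

text \<open>At length m_st the two alternating words agree, so either first letter can be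
  stripped.\<close>

lemma word_length_longest:
  assumes "s \<in> S" "t \<in> S" "s \<noteq> t" "coxeter_order W s t = enat n"
  defines "w \<equiv> val (alt s t n)"
  shows "w \<in> carrier W" "word_length w = n" "word_length (s \<otimes> w) < n" "word_length (t \<otimes> w) < n"
proof -
  obtain k where k: "n = Suc k" using assms coxeter_order_enat by (cases n) auto
  have alt: "alt s t j \<in> lists S" "alt t s j \<in> lists S" for j using alt_in_lists assms by blast+
  show "w \<in> carrier W" using alt by (auto simp: w_def)
  show "word_length w = n" unfolding w_def using assms by (intro word_length_alt) auto
  have "s \<otimes> w = val (alt t s k)" using alt assms by (simp add: w_def k)
  then show "word_length (s \<otimes> w) < n" using word_length_le[OF alt(2), of k] k by simp
  have "w = val (alt t s n)" unfolding w_def using assms by (simp add: val_alt_eq_order)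
  then have "t \<otimes> w = val (alt s t k)" using alt assms by (simp add: k)
  then show "word_length (t \<otimes> w) < n" using word_length_le[OF alt(1), of k] k by simp
qed

subsection \<open>Automorphisms of the Cayley graph\<close>

lemma inv_mult_cancel [simp]:
  "x \<in> carrier W \<Longrightarrow> y \<in> carrier W \<Longrightarrow> inv x \<otimes> (x \<otimes> y) = y"
  "x \<in> carrier W \<Longrightarrow> y \<in> carrier W \<Longrightarrow> x \<otimes> (inv x \<otimes> y) = y"
  by (simp_all flip: m_assoc)

text \<open>Adjacency is written with \<open>inv x \<otimes> y\<close>, as justified by
  \<open>cayley_edge_iff\<close>. Extensionality is left out so that translates can be formed as
  plain functions.\<close>

definition cayley_aut :: "('a \<Rightarrow> 'a) \<Rightarrow> bool" where
  "cayley_aut f \<longleftrightarrow> bij_betw f (carrier W) (carrier W) \<and>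
     (\<forall>x\<in>carrier W. \<forall>y\<in>carrier W. inv (f x) \<otimes> f y \<in> S \<longleftrightarrow> inv x \<otimes> y \<in> S)"

lemma cayley_edge_iff:
  assumes "x \<in> carrier W" "y \<in> carrier W"
  shows "{x, y} \<in> cayley_edges W S \<longleftrightarrow> inv x \<otimes> y \<in> S"
proof
  assume "{x, y} \<in> cayley_edges W S"
  then obtain w s where "w \<in> carrier W" "s \<in> S" "{x, y} = {w, w \<otimes> s}"
    by (auto simp: cayley_edges_def)
  then show "inv x \<otimes> y \<in> S"
    by (auto simp: doubleton_eq_iff inv_mult_group m_assoc)
next
  assume "inv x \<otimes> y \<in> S"
  then show "{x, y} \<in> cayley_edges W S"
    unfolding cayley_edges_def using assms
    by (intro CollectI exI[of _ x] exI[of _ "inv x \<otimes> y"]) auto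
qed

lemma cayley_aut_closed [intro]: "cayley_aut f \<Longrightarrow> x \<in> carrier W \<Longrightarrow> f x \<in> carrier W"
  by (auto simp: cayley_aut_def bij_betw_def)

lemma cayley_aut_group_carrier:
  "f \<in> carrier (cayley_aut_group W S) \<longleftrightarrow> f \<in> extensional (carrier W) \<and> cayley_aut f"
proof -
  have "{f x, f y} \<in> cayley_edges W S \<longleftrightarrow> inv (f x) \<otimes> f y \<in> S"
    if "bij_betw f (carrier W) (carrier W)" "x \<in> carrier W" "y \<in> carrier W" for x y
    using that by (intro cayley_edge_iff) (auto simp: bij_betw_def)
  then show ?thesis
    by (auto simp: cayley_aut_group_def graph_aut_group_def Bij_def cayley_aut_def cayley_edge_iff)
qed

lemma cayley_aut_inv:
  assumes "cayley_aut f" shows "cayley_aut (inv_into (carrier W) f)"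
proof -
  have b: "bij_betw f (carrier W) (carrier W)" using assms by (simp add: cayley_aut_def)
  let ?g = "inv_into (carrier W) f"
  have g: "?g x \<in> carrier W" "f (?g x) = x" if "x \<in> carrier W" for x
    using b that by (auto simp: bij_betw_def intro: inv_into_into f_inv_into_f)
  have "inv (?g x) \<otimes> ?g y \<in> S \<longleftrightarrow> inv x \<otimes> y \<in> S" if "x \<in> carrier W" "y \<in> carrier W" for x y
  proof -
    have "inv (f (?g x)) \<otimes> f (?g y) \<in> S \<longleftrightarrow> inv (?g x) \<otimes> ?g y \<in> S"
      using assms g(1) that unfolding cayley_aut_def by blast
    then show ?thesis using g that by simp
  qed
  then show ?thesis using b by (simp add: cayley_aut_def bij_betw_inv_into)
qed

text \<open>The image of a path is a path of the same length; its labels are collected letter by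
  letter.\<close>

lemma cayley_aut_dist_le:
  assumes f: "cayley_aut f" and x: "x \<in> carrier W" and y: "y \<in> carrier W"
  shows "word_length (inv (f x) \<otimes> f y) \<le> word_length (inv x \<otimes> y)"
proof -
  obtain ws where ws: "ws \<in> lists S" "val ws = inv x \<otimes> y" "length ws = word_length (inv x \<otimes> y)"
    using reduced_word x y by (metis inv_closed m_closed)
  have "\<exists>vs\<in>lists S. length vs = length ws \<and> val vs = inv (f x) \<otimes> f (x \<otimes> val ws)"
    using ws(1)
  proof (induction ws rule: rev_induct)
    case Nil
    then show ?case using cayley_aut_closed[OF f x] x by (intro bexI[of _ "[]"]) auto
  next
    case (snoc a ws)
    then obtain vs where vs: "vs \<in> lists S" "length vs = length ws" "val vs = inv (f x) \<otimes> f (x \<otimes> val ws)"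
      by auto
    have ws: "ws \<in> lists S" and a: "a \<in> S" using snoc by auto
    let ?z = "x \<otimes> val ws" and ?b = "inv (f (x \<otimes> val ws)) \<otimes> f (x \<otimes> val ws \<otimes> a)"
    have z: "?z \<in> carrier W" "?z \<otimes> a \<in> carrier W" using ws a x by (auto intro!: m_closed val_closed)
    have c: "f x \<in> carrier W" "f ?z \<in> carrier W" "f (?z \<otimes> a) \<in> carrier W"
      using f x z by auto
    have "inv ?z \<otimes> (?z \<otimes> a) = a" using z(1) a by simp
    then have b: "?b \<in> S"
      using f z a by (auto simp: cayley_aut_def)
    have "val (vs @ [?b]) = inv (f x) \<otimes> f (x \<otimes> val (ws @ [a]))"
      using vs b c ws a x by (simp add: val_append val_closed m_assoc)
    then show ?case using vs b by (intro bexI[of _ "vs @ [?b]"]) auto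
  qed
  then show ?thesis using ws x y word_length_le by fastforce
qed

lemma cayley_aut_dist:
  assumes f: "cayley_aut f" and x: "x \<in> carrier W" and y: "y \<in> carrier W"
  shows "word_length (inv (f x) \<otimes> f y) = word_length (inv x \<otimes> y)"
proof (rule antisym)
  have "inv_into (carrier W) f (f z) = z" if "z \<in> carrier W" for z
    using f that by (auto simp: cayley_aut_def bij_betw_def)
  then show "word_length (inv x \<otimes> y) \<le> word_length (inv (f x) \<otimes> f y)"
    using cayley_aut_dist_le[OF cayley_aut_inv[OF f], of "f x" "f y"] f x y by auto
qed (rule cayley_aut_dist_le[OF assms])

lemma cayley_aut_left_mult: "w \<in> carrier W \<Longrightarrow> cayley_aut f \<Longrightarrow> cayley_aut (\<lambda>y. w \<otimes> f y)"
  and cayley_aut_right_shift: "w \<in> carrier W \<Longrightarrow> cayley_aut f \<Longrightarrow> cayley_aut (\<lambda>y. f (w \<otimes> y))"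
proof -
  assume w: "w \<in> carrier W" and f: "cayley_aut f"
  have bw: "bij_betw (\<lambda>y. w \<otimes> y) (carrier W) (carrier W)"
    by (rule bij_betw_byWitness[of _ "\<lambda>y. inv w \<otimes> y"]) (use w in auto)
  have bf: "bij_betw f (carrier W) (carrier W)" using f by (simp add: cayley_aut_def)
  have "inv (w \<otimes> x) \<otimes> (w \<otimes> y) = inv x \<otimes> y" if "x \<in> carrier W" "y \<in> carrier W" for x y
    using w that by (simp add: inv_mult_group m_assoc)
  then show "cayley_aut (\<lambda>y. w \<otimes> f y)" "cayley_aut (\<lambda>y. f (w \<otimes> y))"
    using f w cayley_aut_closed[OF f] bij_betw_trans[OF bf bw] bij_betw_trans[OF bw bf]
    by (auto simp: cayley_aut_def comp_def)
qed

section \<open>Automorphisms fixing the identity vertex\<close>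

context
  fixes g
  assumes g: "cayley_aut g" and g_one: "g \<one> = \<one>"
begin

lemma rooted_aut_mem_iff: "y \<in> carrier W \<Longrightarrow> g y \<in> S \<longleftrightarrow> y \<in> S"
  using g g_one cayley_aut_closed[OF g]
  unfolding cayley_aut_def by (metis inv_one l_one one_closed)

lemma rooted_aut_bij: "bij_betw g S S"
proof -
  have "inj_on g S" using g by (auto simp: cayley_aut_def bij_betw_def inj_on_def)
  moreover have "u \<in> g ` S" if "u \<in> S" for u
  proof -
    have "u \<in> g ` carrier W" using g that by (auto simp: cayley_aut_def bij_betw_def)
    then show ?thesis using that rooted_aut_mem_iff by auto
  qed
  ultimately show ?thesis using rooted_aut_mem_iff by (auto simp: bij_betw_def)
qed

lemma rooted_aut_inv_one: "inv_into (carrier W) g \<one> = \<one>"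
  using g g_one by (metis bij_betw_def cayley_aut_def inv_into_f_f one_closed)

lemma rooted_aut_length: "y \<in> carrier W \<Longrightarrow> word_length (g y) = word_length y"
  using cayley_aut_dist[OF g, of \<one> y] g_one cayley_aut_closed[OF g] by simp

lemma rooted_aut_neq: "s \<in> S \<Longrightarrow> t \<in> S \<Longrightarrow> s \<noteq> t \<Longrightarrow> g s \<noteq> g t"
  using rooted_aut_bij by (auto simp: bij_betw_def inj_on_def)

text \<open>Distances to \<open>\<one>\<close>, \<open>s\<close> and \<open>t\<close> are preserved,
  so the image of the longest element has length \<open>n\<close> and left descents
  \<open>g s\<close> and \<open>g t\<close>; \<open>two_descents\<close> then bounds the order of
  their product and identifies the image when \<open>m = n\<close>.\<close>

lemma rooted_aut_longest:
  assumes "s \<in> S" "t \<in> S" "s \<noteq> t" "coxeter_order W s t = enat n"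
  obtains m where "coxeter_order W (g s) (g t) = enat m" "m \<le> n"
    "m = n \<Longrightarrow> g (val (alt s t n)) = val (alt (g s) (g t) n)"
proof -
  let ?w = "val (alt s t n)"
  note w = word_length_longest[OF assms]
  have gS: "g s \<in> S" "g t \<in> S" using rooted_aut_mem_iff assms by auto
  have gw: "g ?w \<in> carrier W" "word_length (g ?w) = n" using w g rooted_aut_length by auto
  have "word_length (g u \<otimes> g ?w) = word_length (u \<otimes> ?w)" if "u \<in> S" for u
    using cayley_aut_dist[OF g, of u ?w] that w rooted_aut_mem_iff[of u] by simp
  then have "word_length (g s \<otimes> g ?w) < word_length (g ?w)"
      "word_length (g t \<otimes> g ?w) < word_length (g ?w)"
    using w gw assms by auto
  from two_descents[OF gS rooted_aut_neq[OF assms(1-3)] gw(1) this] show thesis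
    using that gw(2) by metis
qed

lemma rooted_aut_order_le:
  assumes "s \<in> S" "t \<in> S" "s \<noteq> t"
  shows "coxeter_order W (g s) (g t) \<le> coxeter_order W s t"
proof (cases "coxeter_order W s t")
  case (enat n)
  then obtain m where "coxeter_order W (g s) (g t) = enat m" "m \<le> n"
    using rooted_aut_longest[OF assms] by metis
  then show ?thesis using enat by simp
qed simp

end

lemma rooted_aut_order:
  assumes "cayley_aut g" "g \<one> = \<one>" "s \<in> S" "t \<in> S" "s \<noteq> t"
  shows "coxeter_order W (g s) (g t) = coxeter_order W s t"
proof (rule antisym)
  let ?h = "inv_into (carrier W) g"
  have "?h (g u) = u" if "u \<in> S" for u
    using assms(1) that by (auto simp: cayley_aut_def bij_betw_def)
  then show "coxeter_order W s t \<le> coxeter_order W (g s) (g t)"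
    using rooted_aut_order_le[OF cayley_aut_inv[OF assms(1)] rooted_aut_inv_one[OF assms(1,2)], of "g s" "g t"]
      rooted_aut_mem_iff[OF assms(1,2)] rooted_aut_neq[OF assms] assms by auto
qed (rule rooted_aut_order_le[OF assms])

text \<open>The vertex \<open>s \<otimes> t\<close> lies two steps along the path that spells
  \<open>alt s t n\<close>, at distance at most n - 2 from the longest element. Its image is a
  neighbour of \<open>g s\<close> equally close to the image of that element, and only
  \<open>g s \<otimes> g t\<close> is such a neighbour.\<close>

lemma rooted_aut_mult:
  assumes g: "cayley_aut g" "g \<one> = \<one>" and st: "s \<in> S" "t \<in> S" "s \<noteq> t"
    and n: "coxeter_order W s t = enat n"
  shows "g (s \<otimes> t) = g s \<otimes> g t"
proof -
  let ?s = "g s" and ?t = "g t" and ?w = "val (alt s t n)"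
  have gS: "?s \<in> S" "?t \<in> S" "?s \<noteq> ?t" using rooted_aut_mem_iff[OF g] rooted_aut_neq[OF g] st by auto
  have n': "coxeter_order W ?s ?t = enat n" using rooted_aut_order[OF g st] n by simp
  then have gw: "g ?w = val (alt ?s ?t n)" using rooted_aut_longest[OF g st n] by auto
  obtain k where k: "n = Suc (Suc k)"
    using coxeter_order_ge_2[OF coxeter_system st] n
    \<comment> \<open>The order of a product of distinct generators is at least 2, hence two letters
      can be split off.\<close>
    by (auto simp: numeral_eq_enat dest!: le_Suc_ex)
  have alt: "alt s t j \<in> lists S" "alt ?t ?s j \<in> lists S" for j using alt_in_lists st gS by blast+
  define r where "r = inv ?s \<otimes> g (s \<otimes> t)"
  have st_c: "s \<otimes> t \<in> carrier W" "g (s \<otimes> t) \<in> carrier W" using g st by auto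
  have "inv s \<otimes> (s \<otimes> t) \<in> S" using st by simp
  then have r: "r \<in> S" using g st by (simp add: r_def cayley_aut_def)
  have gst: "g (s \<otimes> t) = ?s \<otimes> r" using st_c gS by (simp add: r_def)
  have "inv (s \<otimes> t) \<otimes> ?w = val (alt s t k)"
    using st alt by (simp add: k inv_mult_group m_assoc val_closed)
  then have "word_length (inv (g (s \<otimes> t)) \<otimes> g ?w) \<le> k"
    using cayley_aut_dist[OF g(1) st_c(1), of ?w] alt word_length_le[OF alt(1), of k]
    by (simp add: val_closed)
  \<comment> \<open>Cancelling \<open>?s\<close> leaves an alternating word of length n - 1,
    strictly below the order, so its first letter \<open>?t\<close> is its only left
    descent.\<close>
  also have "inv (g (s \<otimes> t)) \<otimes> g ?w = r \<otimes> val (alt ?t ?s (Suc k))"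
    unfolding gst gw unfolding k using gS r alt(2)[of "Suc k"] val_closed[OF alt(2), of k]
    by (simp add: inv_mult_group m_assoc)
  finally have "word_length (r \<otimes> val (alt ?t ?s (Suc k))) \<le> k" .
  moreover have ord: "coxeter_order W ?t ?s = enat n"
    using n' coxeter_order_commute[OF coxeter_system] gS by metis
  moreover have "word_length (val (alt ?t ?s (Suc k))) = Suc k"
    using gS by (intro word_length_alt) (auto simp: ord k)
  ultimately have "r = ?t"
    using gS r by (intro alt_unique_descent[of ?t ?s r "Suc k"]) (auto simp: k simp del: alt.simps)
  then show ?thesis using gst by simp
qed

subsection \<open>Rigidity for non-flexible diagrams\<close>

lemma defining_diagram_edge_iff:
  assumes "s \<in> S" "t \<in> S"
  shows "{s, t} \<in> defining_diagram_edges W S \<longleftrightarrow> s \<noteq> t \<and> coxeter_order W s t < \<infinity>"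
  using assms coxeter_order_commute[OF coxeter_system, of s t]
  unfolding defining_diagram_edges_def by (auto simp: doubleton_eq_iff) metis

text \<open>Both diagrams record the same orders: a missing edge of the defining diagram between
  distinct vertices means order \<open>\<infinity>\<close>, so preserving edges and labels preserves
  all orders.\<close>

lemma defining_diagram_automorphism_iff:
  assumes "\<phi> \<in> extensional S"
  shows "\<phi> \<in> defining_diagram_automorphisms W S \<longleftrightarrow> coxeter_diagram_automorphism W S \<phi>"
proof
  assume \<phi>: "\<phi> \<in> defining_diagram_automorphisms W S"
  then have b: "bij_betw \<phi> S S"
    by (auto simp: defining_diagram_automorphisms_def graph_aut_group_def Bij_def)
  have "coxeter_order W (\<phi> s) (\<phi> t) = coxeter_order W s t" if "s \<in> S" "t \<in> S" "s \<noteq> t" for s t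
  proof (cases "{s, t} \<in> defining_diagram_edges W S")
    case True
    then show ?thesis using \<phi> by (simp add: defining_diagram_automorphisms_def)
  next
    case False
    then have "{\<phi> s, \<phi> t} \<notin> defining_diagram_edges W S"
      using \<phi> that by (auto simp: defining_diagram_automorphisms_def graph_aut_group_def)
    moreover have "\<phi> s \<in> S" "\<phi> t \<in> S" "\<phi> s \<noteq> \<phi> t"
      using b that by (auto simp: bij_betw_def inj_on_def)
    ultimately show ?thesis using False that by (simp add: defining_diagram_edge_iff)
  qed
  then show "coxeter_diagram_automorphism W S \<phi>"
    using b by (simp add: coxeter_diagram_automorphism_def)
next
  assume "coxeter_diagram_automorphism W S \<phi>"
  then have b: "bij_betw \<phi> S S"
    and ord: "\<And>s t. s \<in> S \<Longrightarrow> t \<in> S \<Longrightarrow> s \<noteq> t \<Longrightarrow> coxeter_order W (\<phi> s) (\<phi> t) = coxeter_order W s t"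
    by (auto simp: coxeter_diagram_automorphism_def)
  have "\<phi> s \<in> S" "\<phi> s = \<phi> t \<longleftrightarrow> s = t" if "s \<in> S" "t \<in> S" for s t
    using b that by (auto simp: bij_betw_def inj_on_def)
  then have "{\<phi> s, \<phi> t} \<in> defining_diagram_edges W S \<longleftrightarrow> {s, t} \<in> defining_diagram_edges W S"
    if "s \<in> S" "t \<in> S" for s t
    using that ord[of s t] defining_diagram_edge_iff[of s t] defining_diagram_edge_iff[of "\<phi> s" "\<phi> t"]
    by metis
  moreover have "s \<in> S \<and> t \<in> S \<and> s \<noteq> t" if "{s, t} \<in> defining_diagram_edges W S" for s t
    using that by (auto simp: defining_diagram_edges_def doubleton_eq_iff)
  ultimately show "\<phi> \<in> defining_diagram_automorphisms W S"
    using b ord assms by (auto simp: defining_diagram_automorphisms_def graph_aut_group_def Bij_def)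
qed

lemma coxeter_diagram_automorphism_comp:
  assumes "coxeter_diagram_automorphism W S \<pi>" "coxeter_diagram_automorphism W S \<rho>"
  shows "coxeter_diagram_automorphism W S (\<pi> \<circ> \<rho>)"
  unfolding coxeter_diagram_automorphism_def
proof (intro conjI ballI impI)
  show "bij_betw (\<pi> \<circ> \<rho>) S S"
    using assms bij_betw_trans unfolding coxeter_diagram_automorphism_def by blast
  fix s t assume st: "s \<in> S" "t \<in> S" "s \<noteq> t"
  then have "\<rho> s \<in> S" "\<rho> t \<in> S" "\<rho> s \<noteq> \<rho> t"
    using assms(2) by (auto simp: coxeter_diagram_automorphism_def bij_betw_def inj_on_def)
  then show "coxeter_order W ((\<pi> \<circ> \<rho>) s) ((\<pi> \<circ> \<rho>) t) = coxeter_order W s t"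
    using assms st by (simp add: coxeter_diagram_automorphism_def)
qed

lemma coxeter_diagram_automorphism_inv:
  assumes "coxeter_diagram_automorphism W S \<pi>"
  shows "coxeter_diagram_automorphism W S (inv_into S \<pi>)"
  unfolding coxeter_diagram_automorphism_def
proof (intro conjI ballI impI)
  have b: "bij_betw \<pi> S S" using assms by (simp add: coxeter_diagram_automorphism_def)
  then show "bij_betw (inv_into S \<pi>) S S" by (rule bij_betw_inv_into)
  fix s t assume st: "s \<in> S" "t \<in> S" "s \<noteq> t"
  have "inv_into S \<pi> u \<in> S" "\<pi> (inv_into S \<pi> u) = u" if "u \<in> S" for u
    using b that by (auto simp: bij_betw_def intro: inv_into_into f_inv_into_f)
  then show "coxeter_order W (inv_into S \<pi> s) (inv_into S \<pi> t) = coxeter_order W s t"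
    using assms st unfolding coxeter_diagram_automorphism_def by metis
qed

lemma coxeter_diagram_automorphism_restrict:
  assumes "coxeter_diagram_automorphism W S \<pi>"
  shows "coxeter_diagram_automorphism W S (restrict \<pi> S)"
  using assms by (simp add: coxeter_diagram_automorphism_def bij_betw_restrict_eq)

text \<open>Defined on all of \<open>W\<close>, this is the translate of \<open>f\<close> that fixes
  \<open>\<one>\<close>; its restriction to \<open>S\<close> is the permutation of labels at
  \<open>x\<close>.\<close>

definition local_perm :: "('a \<Rightarrow> 'a) \<Rightarrow> 'a \<Rightarrow> 'a \<Rightarrow> 'a" where
  "local_perm f x s = inv (f x) \<otimes> f (x \<otimes> s)"

lemma cayley_aut_rooted:
  assumes "cayley_aut f" "x \<in> carrier W"
  shows "cayley_aut (local_perm f x)" "local_perm f x \<one> = \<one>"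
proof -
  have "local_perm f x = (\<lambda>s. inv (f x) \<otimes> f (x \<otimes> s))" by (simp add: local_perm_def fun_eq_iff)
  then show "cayley_aut (local_perm f x)" "local_perm f x \<one> = \<one>"
    using cayley_aut_left_mult[OF _ cayley_aut_right_shift[OF assms(2,1)], of "inv (f x)"]
      cayley_aut_closed[OF assms] assms(2) by simp_all
qed

lemma local_perm_diagram_automorphism:
  assumes "cayley_aut f" "x \<in> carrier W"
  shows "coxeter_diagram_automorphism W S (local_perm f x)"
  using rooted_aut_bij[OF cayley_aut_rooted[OF assms]] rooted_aut_order[OF cayley_aut_rooted[OF assms]]
  by (simp add: coxeter_diagram_automorphism_def)

text \<open>After translating \<open>x\<close> to \<open>\<one>\<close> the claim becomes
  multiplicativity of the rooted automorphism on \<open>s \<otimes> t\<close>, which is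
  \<open>rooted_aut_mult\<close>, or trivial when \<open>s = t\<close>.\<close>

lemma local_perm_adjacent:
  assumes f: "cayley_aut f" and x: "x \<in> carrier W" and st: "s \<in> S" "t \<in> S"
    and "s = t \<or> coxeter_order W s t < \<infinity>"
  shows "local_perm f (x \<otimes> s) t = local_perm f x t"
proof -
  let ?g = "local_perm f x"
  note g = cayley_aut_rooted[OF f x]
  have gS: "?g s \<in> S" "?g t \<in> S" using rooted_aut_mem_iff[OF g] st by auto
  have c: "f x \<in> carrier W" "f (x \<otimes> u) \<in> carrier W" if "u \<in> carrier W" for u
    using f x that by auto
  have "?g (s \<otimes> t) = ?g s \<otimes> ?g t"
  proof (cases "s = t")
    case True
    then show ?thesis using gS st g(2) by simp
  next
    case False
    then show ?thesis using rooted_aut_mult[OF g st False] assms(5) by auto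
  qed
  then have "f x \<otimes> ?g (s \<otimes> t) = f x \<otimes> ?g s \<otimes> ?g t"
    using c[of s] st gS by (simp add: m_assoc)
  moreover have "f x \<otimes> ?g u = f (x \<otimes> u)" if "u \<in> carrier W" for u
    using c that by (simp add: local_perm_def)
  ultimately have "f (x \<otimes> s \<otimes> t) = f (x \<otimes> s) \<otimes> ?g t"
    using st x by (simp add: m_assoc)
  then show ?thesis unfolding local_perm_def[of f "x \<otimes> s"] using c[of s] gS st by simp
qed

text \<open>Across an edge labelled \<open>s\<close> the two label permutations agree on the star of
  \<open>s\<close>. Their quotient \<open>?\<phi>\<close> is therefore a diagram automorphism fixing
  that star, and non-flexibility makes it trivial.\<close>

lemma local_perm_constant:
  assumes "\<not> flexible W S" "cayley_aut f" "x \<in> carrier W" "t \<in> S"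
  shows "local_perm f x t = local_perm f \<one> t"
  using assms(3)
proof (induction rule: generator_induct)
  case (step x s)
  let ?\<pi> = "local_perm f x" and ?\<rho> = "local_perm f (x \<otimes> s)"
  let ?\<phi> = "restrict (inv_into S ?\<pi> \<circ> ?\<rho>) S"
  have \<pi>: "coxeter_diagram_automorphism W S ?\<pi>" "coxeter_diagram_automorphism W S ?\<rho>"
    using local_perm_diagram_automorphism assms(2) step by auto
  then have b: "bij_betw ?\<pi> S S" "bij_betw ?\<rho> S S" by (auto simp: coxeter_diagram_automorphism_def)
  have "?\<phi> \<in> defining_diagram_automorphisms W S"
    by (subst defining_diagram_automorphism_iff)
      (auto intro!: coxeter_diagram_automorphism_restrict coxeter_diagram_automorphism_comp
        coxeter_diagram_automorphism_inv \<pi> simp del: restrict_apply)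
  moreover have star: "?\<phi> u = u" if "u \<in> S" "s = u \<or> coxeter_order W s u < \<infinity>" for u
    using local_perm_adjacent[OF assms(2) step(1) step(2) that] that b(1)
    by (auto simp: bij_betw_def)
  moreover have "?\<phi> u = u" if "u \<in> S" "{s, u} \<in> defining_diagram_edges W S" for u
    using star[OF that(1)] that step(2) by (auto simp: defining_diagram_edge_iff simp del: restrict_apply)
  ultimately have "?\<phi> t = t"
    using assms(1,4) step(2) unfolding flexible_def by blast
  then have "?\<rho> t = ?\<pi> t"
    using assms(4) b by (simp add: bij_betw_def) (metis f_inv_into_f image_eqI)
  then show ?case using step by simp
qed simp

lemma left_mult_aut: "w \<in> carrier W \<Longrightarrow> left_mult W w \<in> Bij (carrier W)"
proof -
  assume w: "w \<in> carrier W"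
  have "bij_betw (\<lambda>y. w \<otimes> y) (carrier W) (carrier W)"
    by (rule bij_betw_byWitness[of _ "\<lambda>y. inv w \<otimes> y"]) (use w in auto)
  then show ?thesis by (simp add: left_mult_def Bij_def bij_betw_restrict_eq)
qed

lemma cayley_aut_group_mult:
  assumes "w \<in> carrier W" "\<delta> \<in> Bij (carrier W)" "x \<in> carrier W"
  shows "(left_mult W w \<otimes>\<^bsub>cayley_aut_group W S\<^esub> \<delta>) x = w \<otimes> \<delta> x"
proof -
  have "\<delta> x \<in> carrier W" using assms by (auto simp: Bij_def bij_betw_def)
  then show ?thesis
    using assms left_mult_aut[OF assms(1)]
    by (simp add: cayley_aut_group_def graph_aut_group_def BijGroup_def compose_def)
      (simp add: left_mult_def)
qed

lemma rigid_decomposition: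
  assumes flex: "\<not> flexible W S" and f: "f \<in> carrier (cayley_aut_group W S)"
  shows "\<exists>l \<in> left_mult_automorphisms W. \<exists>\<delta> \<in> diagram_automorphisms W S.
           f = l \<otimes>\<^bsub>cayley_aut_group W S\<^esub> \<delta>"
proof -
  have fe: "f \<in> extensional (carrier W)" and fa: "cayley_aut f"
    using f by (auto simp: cayley_aut_group_carrier)
  let ?\<delta> = "restrict (local_perm f \<one>) (carrier W)"
  note g = cayley_aut_rooted[OF fa one_closed]
  have c: "f x \<in> carrier W" if "x \<in> carrier W" for x using fa that by auto
  have d: "local_perm f \<one> x \<in> carrier W" if "x \<in> carrier W" for x using g that by auto
  have bij: "?\<delta> \<in> Bij (carrier W)"
    using g by (simp add: Bij_def cayley_aut_def bij_betw_restrict_eq)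
  \<comment> \<open>With the same label permutation at every vertex, the translate of
    \<open>f\<close> fixing \<open>\<one>\<close> respects right multiplication by generators; this
    is what turns it into a homomorphism.\<close>
  have hom_step: "local_perm f \<one> (x \<otimes> s) = local_perm f \<one> x \<otimes> local_perm f \<one> s"
    if "x \<in> carrier W" "s \<in> S" for x s
  proof -
    have "local_perm f \<one> (x \<otimes> s) = inv (f \<one>) \<otimes> (f x \<otimes> local_perm f x s)"
      using that c by (simp add: local_perm_def)
    also have "local_perm f x s = local_perm f \<one> s"
      using local_perm_constant[OF flex fa] that by blast
    also have "inv (f \<one>) \<otimes> (f x \<otimes> local_perm f \<one> s) = local_perm f \<one> x \<otimes> local_perm f \<one> s"
      using that c d[of s] by (simp add: local_perm_def[of f \<one> x] m_assoc)
    finally show ?thesis .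
  qed
  have "local_perm f \<one> (x \<otimes> y) = local_perm f \<one> x \<otimes> local_perm f \<one> y"
    if "x \<in> carrier W" "y \<in> carrier W" for x y
    using that(2)
  proof (induction rule: generator_induct)
    case one
    then show ?case using that g(2) d by simp
  next
    case (step y s)
    have "x \<otimes> (y \<otimes> s) = x \<otimes> y \<otimes> s" using step that by (simp add: m_assoc)
    then show ?case
      using step that d by (simp add: hom_step) (simp add: m_assoc)
  qed
  then have "?\<delta> \<in> hom W W" using d by (auto simp: hom_def)
  moreover have "coxeter_diagram_automorphism W S (local_perm f \<one>)"
    using local_perm_diagram_automorphism fa by simp
  ultimately have "?\<delta> \<in> diagram_automorphisms W S"
    using bij by (auto simp: diagram_automorphisms_def auto_def intro!: exI[of _ "local_perm f \<one>"])
  moreover have "left_mult W (f \<one>) \<in> left_mult_automorphisms W"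
    using c by (auto simp: left_mult_automorphisms_def)
  moreover have "f = left_mult W (f \<one>) \<otimes>\<^bsub>cayley_aut_group W S\<^esub> ?\<delta>"
  proof (rule extensionalityI[OF fe])
    show "left_mult W (f \<one>) \<otimes>\<^bsub>cayley_aut_group W S\<^esub> ?\<delta> \<in> extensional (carrier W)"
      using left_mult_aut[of "f \<one>"] c bij
      by (simp add: cayley_aut_group_def graph_aut_group_def BijGroup_def compose_extensional)
    fix x assume x: "x \<in> carrier W"
    then show "f x = (left_mult W (f \<one>) \<otimes>\<^bsub>cayley_aut_group W S\<^esub> ?\<delta>) x"
      using cayley_aut_group_mult[OF _ bij x, of "f \<one>"] c by (simp add: local_perm_def)
  qed
  ultimately show ?thesis by blast
qed

subsection \<open>Twisting along a coset for flexible diagrams\<close>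

lemma val_in_parabolic: "J \<subseteq> S \<Longrightarrow> ws \<in> lists J \<Longrightarrow> val ws \<in> generate W J"
  by (induction ws) (auto intro: generate.intros)

lemma generator_not_in_parabolic:
  assumes "s \<in> S" shows "s \<notin> generate W (S - {s})"
proof
  assume "s \<in> generate W (S - {s})"
  then obtain ws where "ws \<in> lists (S - {s})" "val ws = s"
    using parabolic_word[of "S - {s}" s] by blast
  then show False using generator_in_parabolic[of "S - {s}" ws] assms by auto
qed

text \<open>
  If \<open>(st)\<^sup>k\<close> with \<open>k > 0\<close> were a word in the other generators, then the wall of \<open>s\<close>, which separates
  it from \<open>\<one>\<close>, would be crossed by that word, making \<open>s\<close> conjugate inside the parabolic subgroup
  to a generator other than \<open>s\<close>.
\<close>

lemma infinite_order_power_not_in_parabolic: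
  assumes "s \<in> S" "t \<in> S" "s \<noteq> t" "coxeter_order W s t = \<infinity>" "0 < k"
  shows "(s \<otimes> t) [^] (k::nat) \<notin> generate W (S - {s})"
proof
  let ?J = "S - {s}" and ?w = "(s \<otimes> t) [^] k"
  assume "?w \<in> generate W ?J"
  then obtain ws where ws: "ws \<in> lists ?J" "val ws = ?w"
    using parabolic_word[of ?J ?w] by blast
  then have wsS: "ws \<in> lists S" by auto
  have alt: "alt s t j \<in> lists S" "alt t s j \<in> lists S" for j using alt_in_lists assms by blast+
  have pow: "val (alt s t (2 * j)) = (s \<otimes> t) [^] j" for j
  proof (induction j)
    case (Suc j)
    then have "val (alt s t (2 * Suc j)) = s \<otimes> t \<otimes> (s \<otimes> t) [^] j"
      using assms by (simp add: m_assoc)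
    also have "\<dots> = (s \<otimes> t) [^] Suc j" using assms by (subst nat_pow_Suc2) auto
    finally show ?case .
  qed simp
  \<comment> \<open>The power is the alternating word of length \<open>2 * k\<close>, reduced
    because the order is infinite; being nonempty it starts with \<open>s\<close>, which is thus a
    left descent.\<close>
  obtain j where j: "2 * k = Suc j" using assms(5) by (cases "2 * k") auto
  have len: "word_length (val (alt s t i)) = i" for i
    using assms by (intro word_length_alt) auto
  have "s \<otimes> val (alt s t (Suc j)) = val (alt t s j)"
    using assms(1) alt by (simp add: val_closed)
  then have "word_length (s \<otimes> ?w) < word_length ?w"
    using word_length_le[OF alt(2), of j] len[of "Suc j"] pow[of k] j by simp
  then obtain i where i: "i < length ws" "s \<otimes> val (take i ws) = val (take (Suc i) ws)"
    using exchange[OF assms(1) wsS] ws by auto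
  have take: "take n ws \<in> lists ?J" "take n ws \<in> lists S" for n
    using ws by (auto dest: in_set_takeD)
  have "s = val (take (Suc i) ws) \<otimes> inv (val (take i ws))"
    using inv_solve_right[of s "val (take (Suc i) ws)" "val (take i ws)"] i(2) assms(1) take
      val_closed generator_closed by presburger
  also have "\<dots> = val (take (Suc i) ws @ rev (take i ws))"
    using take[of i] take[of "Suc i"] by (subst val_append) (auto simp: val_rev)
  also have "\<dots> \<in> generate W ?J"
    using take[of i] take[of "Suc i"] by (intro val_in_parabolic) auto
  finally show False using generator_not_in_parabolic assms(1) by blast
qed

text \<open>
  Only edges labelled \<open>s\<close> leave a union \<open>B\<close> of left cosets of \<open>\<langle>S - {s}\<rangle>\<close>.  Hence a
  2-coloured finite cycle either stays inside \<open>B\<close> or outside \<open>B\<close>, or has both labels in the star of \<open>s\<close>.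
  The choices \<open>(id, \<phi>)\<close> and \<open>(\<phi>\<^sup>-\<^sup>1, id)\<close> for \<open>(\<alpha>, \<beta>)\<close> yield a twist and its inverse.
\<close>

lemma twisted_pair:
  assumes s: "s \<in> S"
    and B: "\<And>x t. x \<in> carrier W \<Longrightarrow> t \<in> S \<Longrightarrow> t \<noteq> s \<Longrightarrow> x \<otimes> t \<in> B \<longleftrightarrow> x \<in> B"
    and \<alpha>: "coxeter_diagram_automorphism W S \<alpha>" "\<And>t. t \<in> S \<Longrightarrow> t = s \<or> coxeter_order W s t < \<infinity> \<Longrightarrow> \<alpha> t = t"
    and \<beta>: "coxeter_diagram_automorphism W S \<beta>" "\<And>t. t \<in> S \<Longrightarrow> t = s \<or> coxeter_order W s t < \<infinity> \<Longrightarrow> \<beta> t = t"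
  obtains a b where "a \<one> = \<one>" "b \<one> = \<one>"
    "\<And>w. w \<in> carrier W \<Longrightarrow> a w \<in> carrier W" "\<And>w. w \<in> carrier W \<Longrightarrow> b w \<in> carrier W"
    "\<And>w t. w \<in> carrier W \<Longrightarrow> t \<in> S \<Longrightarrow> a (w \<otimes> t) = a w \<otimes> (if a w \<in> B then \<alpha> t else t)"
    "\<And>w t. w \<in> carrier W \<Longrightarrow> t \<in> S \<Longrightarrow> b (w \<otimes> t) = b w \<otimes> (if a w \<in> B then \<beta> t else t)"
proof -
  define p where "p x t = (if x \<in> B then \<alpha> t else t)" for x t
  define q where "q x t = (if x \<in> B then \<beta> t else t)" for x t
  \<comment> \<open>The first component alone decides, by its position relative to \<open>B\<close>,
    how the next label is twisted in both components.\<close>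
  define A where "A t z = (fst z \<otimes> p (fst z) t, snd z \<otimes> q (fst z) t)" for t z
  have \<alpha>S: "\<alpha> t \<in> S" and \<beta>S: "\<beta> t \<in> S" if "t \<in> S" for t
    using \<alpha>(1) \<beta>(1) that by (auto simp: coxeter_diagram_automorphism_def bij_betw_def)
  have pS: "p x t \<in> S" and qS: "q x t \<in> S" if "t \<in> S" for x t
    using \<alpha>S \<beta>S that by (auto simp: p_def q_def)
  have \<alpha>s: "\<alpha> t = s \<longleftrightarrow> t = s" if "t \<in> S" for t
    using \<alpha>(1) \<alpha>(2)[of s] s that by (auto simp: coxeter_diagram_automorphism_def bij_betw_def inj_on_def)
  \<comment> \<open>Moving along \<open>t\<close> does not change the twist of \<open>u\<close>: if
    \<open>t = s\<close>, then \<open>u\<close> lies in the star of \<open>s\<close> and is fixed;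
    otherwise the twisted edge is not labelled \<open>s\<close> and stays on one side of
    \<open>B\<close>.\<close>
  have same: "p (x \<otimes> p x t) u = p x u" "q (x \<otimes> p x t) u = q x u"
    if "x \<in> carrier W" "t \<in> S" "u \<in> S" "t = u \<or> coxeter_order W t u < \<infinity>" for x t u
  proof -
    have "p (x \<otimes> p x t) u = p x u \<and> q (x \<otimes> p x t) u = q x u"
    proof (cases "t = s")
      case True
      then have "\<alpha> u = u" "\<beta> u = u" using \<alpha>(2)[of u] \<beta>(2)[of u] that by auto
      then show ?thesis by (auto simp: p_def q_def)
    next
      case False
      then have "p x t \<noteq> s" using \<alpha>s that by (auto simp: p_def)
      then have "x \<otimes> p x t \<in> B \<longleftrightarrow> x \<in> B" using B pS that by blast
      then show ?thesis by (auto simp: p_def q_def)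
    qed
    then show "p (x \<otimes> p x t) u = p x u" "q (x \<otimes> p x t) u = q x u" by auto
  qed
  have "\<exists>h. h \<one> = (\<one>, \<one>) \<and> (\<forall>w\<in>carrier W. h w \<in> carrier W \<times> carrier W) \<and>
             (\<forall>w\<in>carrier W. \<forall>s\<in>S. h (w \<otimes> s) = A s (h w))"
  proof (rule orbit_map)
    fix t z assume "t \<in> S" "z \<in> carrier W \<times> carrier W"
    then show "A t (A t z) = z"
      using same pS qS by (auto simp: A_def)
  next
    fix t u n z
    assume tu: "t \<in> S" "u \<in> S" "t \<noteq> u" "coxeter_order W t u = enat n" and z: "z \<in> carrier W \<times> carrier W"
    have ut: "coxeter_order W u t = enat n"
      using tu coxeter_order_commute[OF coxeter_system] by metis
    obtain x y where [simp]: "z = (x, y)" by (cases z)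
    have [simp]: "x \<in> carrier W" "y \<in> carrier W" using z by auto
    define d e where "d = p x t \<otimes> p x u" and "e = q x t \<otimes> q x u"
    have c [simp]: "p x' v \<in> carrier W" "q x' v \<in> carrier W" if "v \<in> S" for x' v using pS qS that by auto
    have [simp]: "d \<in> carrier W" "e \<in> carrier W" using tu by (auto simp: d_def e_def)
    have iter: "((\<lambda>z. A u (A t z)) ^^ k) z = (x \<otimes> d [^] k, y \<otimes> e [^] k) \<and>
        (\<forall>v\<in>{t, u}. p (x \<otimes> d [^] k) v = p x v \<and> q (x \<otimes> d [^] k) v = q x v)" for k
    proof (induction k)
      case 0
      then show ?case by simp
    next
      case (Suc k)
      let ?x = "x \<otimes> d [^] k"
      have pk: "p ?x v = p x v" "q ?x v = q x v" if "v \<in> {t, u}" for v using Suc that by auto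
      have s1: "p (?x \<otimes> p x t) v = p x v" "q (?x \<otimes> p x t) v = q x v" if "v \<in> {t, u}" for v
        using same[of ?x t v] that tu pk by auto
      have s2: "p (?x \<otimes> p x t \<otimes> p x u) v = p x v" "q (?x \<otimes> p x t \<otimes> p x u) v = q x v" if "v \<in> {t, u}" for v
        using same[of "?x \<otimes> p x t" u v] that tu ut s1 by auto
      have "A u (A t (?x, y \<otimes> e [^] k)) = (?x \<otimes> p x t \<otimes> p x u, y \<otimes> e [^] k \<otimes> q x t \<otimes> q x u)"
        by (simp add: A_def pk s1)
      moreover have "?x \<otimes> p x t \<otimes> p x u = x \<otimes> d [^] Suc k" "y \<otimes> e [^] k \<otimes> q x t \<otimes> q x u = y \<otimes> e [^] Suc k"
        using tu by (simp_all add: d_def e_def m_assoc)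
      ultimately show ?case using Suc s2 by simp
    qed
    \<comment> \<open>Along the cycle the twists are constant and preserve orders, so both
      components return after \<open>n\<close> rounds.\<close>
    have "coxeter_order W (p x t) (p x u) = enat n" "coxeter_order W (q x t) (q x u) = enat n"
      using tu \<alpha>(1) \<beta>(1) by (auto simp: p_def q_def coxeter_diagram_automorphism_def)
    then have "d [^] n = \<one>" "e [^] n = \<one>"
      using coxeter_order_enat[of "p x t" "p x u" n] coxeter_order_enat[of "q x t" "q x u" n] pS qS tu
        pow_ord_eq_1[of d] pow_ord_eq_1[of e] by (auto simp: d_def e_def)
    then show "((\<lambda>z. A u (A t z)) ^^ n) z = z" using iter[of n] by simp
  next
    fix t z assume "t \<in> S" "z \<in> carrier W \<times> carrier W"
    then show "A t z \<in> carrier W \<times> carrier W" using pS qS by (auto simp: A_def)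
  qed auto
  then obtain h where h: "h \<one> = (\<one>, \<one>)" "\<And>w. w \<in> carrier W \<Longrightarrow> h w \<in> carrier W \<times> carrier W"
      "\<And>w s. w \<in> carrier W \<Longrightarrow> s \<in> S \<Longrightarrow> h (w \<otimes> s) = A s (h w)" by blast
  show thesis
  proof (rule that[of "fst \<circ> h" "snd \<circ> h"])
    fix w assume w: "w \<in> carrier W"
    show "(fst \<circ> h) w \<in> carrier W" "(snd \<circ> h) w \<in> carrier W" using h(2)[OF w] by auto
    fix t assume t: "t \<in> S"
    show "(fst \<circ> h) (w \<otimes> t) = (fst \<circ> h) w \<otimes> (if (fst \<circ> h) w \<in> B then \<alpha> t else t)"
      "(snd \<circ> h) (w \<otimes> t) = (snd \<circ> h) w \<otimes> (if (fst \<circ> h) w \<in> B then \<beta> t else t)"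
      using h(3)[OF w t] by (auto simp: A_def p_def q_def)
  qed (auto simp: h)
qed

text \<open>The twist \<open>f\<close> tests membership in \<open>B\<close> at the source vertex and
  its inverse \<open>g\<close> at the target vertex. Both tests fall on the same vertex in the
  compositions, so the label changes cancel.\<close>

lemma twist_exists:
  assumes s: "s \<in> S"
    and B: "\<And>x t. x \<in> carrier W \<Longrightarrow> t \<in> S \<Longrightarrow> t \<noteq> s \<Longrightarrow> x \<otimes> t \<in> B \<longleftrightarrow> x \<in> B"
    and \<phi>: "coxeter_diagram_automorphism W S \<phi>" "\<And>t. t \<in> S \<Longrightarrow> t = s \<or> coxeter_order W s t < \<infinity> \<Longrightarrow> \<phi> t = t"
  obtains f where "cayley_aut f" "f \<one> = \<one>"
    "\<And>w t. w \<in> carrier W \<Longrightarrow> t \<in> S \<Longrightarrow> f (w \<otimes> t) = f w \<otimes> (if w \<in> B then \<phi> t else t)"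
proof -
  have id: "coxeter_diagram_automorphism W S (\<lambda>t. t)"
    by (simp add: coxeter_diagram_automorphism_def bij_betw_def)
  let ?\<psi> = "inv_into S \<phi>"
  have b: "bij_betw \<phi> S S" using \<phi>(1) by (simp add: coxeter_diagram_automorphism_def)
  have \<psi>\<phi>: "?\<psi> (\<phi> t) = t" "\<phi> (?\<psi> t) = t" "\<phi> t \<in> S" "?\<psi> t \<in> S" if "t \<in> S" for t
    using b that by (auto simp: bij_betw_def f_inv_into_f inv_into_into)
  have \<psi>: "?\<psi> t = t" if "t \<in> S" "t = s \<or> coxeter_order W s t < \<infinity>" for t
    using \<psi>\<phi>(1)[OF that(1)] \<phi>(2)[OF that] by simp
  obtain i f where i1: "i \<one> = \<one>" and f1: "f \<one> = \<one>"
    and "\<And>w. w \<in> carrier W \<Longrightarrow> i w \<in> carrier W" and fc: "\<And>w. w \<in> carrier W \<Longrightarrow> f w \<in> carrier W"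
    and i: "\<And>w t. w \<in> carrier W \<Longrightarrow> t \<in> S \<Longrightarrow> i (w \<otimes> t) = i w \<otimes> (if i w \<in> B then t else t)"
    and f: "\<And>w t. w \<in> carrier W \<Longrightarrow> t \<in> S \<Longrightarrow> f (w \<otimes> t) = f w \<otimes> (if i w \<in> B then \<phi> t else t)"
    by (rule twisted_pair[OF s B id HOL.refl \<phi>]) (assumption | rule that)+
  \<comment> \<open>For \<alpha> the identity, the first component is the current vertex itself, so
    the test concerns \<open>w\<close>.\<close>
  have "i w = w" if "w \<in> carrier W" for w
    using that by (induction rule: generator_induct) (simp_all add: i i1)
  then have f_step: "f (w \<otimes> t) = f w \<otimes> (if w \<in> B then \<phi> t else t)" if "w \<in> carrier W" "t \<in> S" for w t
    using f that by simp
  obtain g j where g1: "g \<one> = \<one>" and "j \<one> = \<one>"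
    and gc: "\<And>w. w \<in> carrier W \<Longrightarrow> g w \<in> carrier W" and "\<And>w. w \<in> carrier W \<Longrightarrow> j w \<in> carrier W"
    and g: "\<And>w t. w \<in> carrier W \<Longrightarrow> t \<in> S \<Longrightarrow> g (w \<otimes> t) = g w \<otimes> (if g w \<in> B then ?\<psi> t else t)"
    and "\<And>w t. w \<in> carrier W \<Longrightarrow> t \<in> S \<Longrightarrow> j (w \<otimes> t) = j w \<otimes> (if g w \<in> B then t else t)"
    by (rule twisted_pair[OF s B coxeter_diagram_automorphism_inv[OF \<phi>(1)] \<psi> id HOL.refl])
      (assumption | rule that)+
  have gf: "g (f w) = w" if "w \<in> carrier W" for w
    using that
  proof (induction rule: generator_induct)
    case (step w t)
    then show ?case
      using g[OF fc[OF step(1)], of "\<phi> t"] g[OF fc[OF step(1)], of t] \<psi>\<phi>[OF step(2)]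
      by (simp add: f_step)
  qed (simp add: f1 g1)
  have fg: "f (g w) = w" if "w \<in> carrier W" for w
    using that
  proof (induction rule: generator_induct)
    case (step w t)
    then show ?case
      using f_step[OF gc[OF step(1)], of "?\<psi> t"] f_step[OF gc[OF step(1)], of t] \<psi>\<phi>[OF step(2)]
      by (simp add: g)
  qed (simp add: f1 g1)
  have bij: "bij_betw f (carrier W) (carrier W)"
    by (rule bij_betw_byWitness[of _ g]) (use fc gc gf fg in auto)
  have "inv (f x) \<otimes> f y \<in> S \<longleftrightarrow> inv x \<otimes> y \<in> S" if xy: "x \<in> carrier W" "y \<in> carrier W" for x y
  proof
    assume r: "inv x \<otimes> y \<in> S"
    have "f y = f (x \<otimes> (inv x \<otimes> y))" by (simp only: inv_mult_cancel(2)[OF xy])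
    also have "\<dots> = f x \<otimes> (if x \<in> B then \<phi> (inv x \<otimes> y) else inv x \<otimes> y)"
      using f_step[OF xy(1) r] .
    finally have "inv (f x) \<otimes> f y = (if x \<in> B then \<phi> (inv x \<otimes> y) else inv x \<otimes> y)"
      using fc[OF xy(1)] r \<psi>\<phi>(3)[OF r] by simp
    then show "inv (f x) \<otimes> f y \<in> S" using r \<psi>\<phi>(3) by simp
  next
    assume r: "inv (f x) \<otimes> f y \<in> S"
    let ?r = "inv (f x) \<otimes> f y"
    have "y = g (f x \<otimes> ?r)"
      using inv_mult_cancel(2)[OF fc[OF xy(1)] fc[OF xy(2)]] gf[OF xy(2)] by simp
    also have "\<dots> = x \<otimes> (if x \<in> B then ?\<psi> ?r else ?r)"
      using g[OF fc[OF xy(1)] r] gf[OF xy(1)] by simp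
    finally have "inv x \<otimes> y = (if x \<in> B then ?\<psi> ?r else ?r)"
      using inv_mult_cancel(1)[OF xy(1), of "if x \<in> B then ?\<psi> ?r else ?r"] r \<psi>\<phi>(4)[OF r] by auto
    then show "inv x \<otimes> y \<in> S" using r \<psi>\<phi>(4) by simp
  qed
  then have "cayley_aut f" using bij by (simp add: cayley_aut_def)
  then show thesis using that f1 f_step by blast
qed

text \<open>The cosets of the powers of \<open>s \<otimes> t\<close> are pairwise distinct by the
  preceding lemma on powers. If all met \<open>F\<close>, choosing a point in each would inject the
  natural numbers into \<open>F\<close>.\<close>

lemma coset_avoiding_finite_set:
  assumes "s \<in> S" "t \<in> S" "s \<noteq> t" "coxeter_order W s t = \<infinity>" "finite F"
  shows "\<exists>c\<in>carrier W. \<forall>p\<in>generate W (S - {s}). c \<otimes> p \<notin> F"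
proof (rule ccontr)
  let ?P = "generate W (S - {s})" and ?d = "s \<otimes> t"
  assume "\<not> ?thesis"
  then have "\<exists>p\<in>?P. ?d [^] (k::nat) \<otimes> p \<in> F" for k
    using assms by auto
  then obtain p where p: "\<And>k::nat. p k \<in> ?P" "\<And>k. ?d [^] k \<otimes> p k \<in> F" by metis
  have sub: "subgroup ?P W" by (intro generate_is_subgroup) auto
  have pc: "p k \<in> carrier W" for k using p(1) sub subgroup.mem_carrier by fast
  have d: "?d \<in> carrier W" using assms by simp
  have "False" if "?d [^] k \<otimes> p k = ?d [^] l \<otimes> p l" "k < l" for k l
  proof -
    have "?d [^] l = ?d [^] k \<otimes> ?d [^] (l - k)" using that d by (simp add: nat_pow_mult)
    then have "?d [^] k \<otimes> p k = ?d [^] k \<otimes> (?d [^] (l - k) \<otimes> p l)"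
      using that d pc by (simp add: m_assoc)
    then have "p k = ?d [^] (l - k) \<otimes> p l" using d pc by simp
    then have "?d [^] (l - k) = p k \<otimes> inv (p l)"
      using inv_solve_right[of "?d [^] (l - k)" "p k" "p l"] d pc by simp
    also have "\<dots> \<in> ?P" using p(1) sub by (simp add: subgroup.m_closed subgroup.m_inv_closed)
    finally show False using infinite_order_power_not_in_parabolic[OF assms(1-4), of "l - k"] that by simp
  qed
  then have "inj (\<lambda>k. ?d [^] k \<otimes> p k)" by (auto intro!: linorder_injI)
  moreover have "range (\<lambda>k. ?d [^] k \<otimes> p k) \<subseteq> F" using p(2) by auto
  ultimately show False using assms(5) finite_subset finite_imageD infinite_UNIV_nat by metis
qed

lemma flexible_small_automorphism:
  assumes "flexible W S" "finite F" "F \<subseteq> carrier W"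
  obtains f where "cayley_aut f" "\<forall>x\<in>F. f x = x" "\<exists>x\<in>carrier W. f x \<noteq> x"
proof -
  obtain s \<phi> t where s: "s \<in> S" and \<phi>: "\<phi> \<in> defining_diagram_automorphisms W S"
    and t: "t \<in> S" "\<phi> t \<noteq> t" and \<phi>s: "\<phi> s = s"
    and nb: "\<And>u. u \<in> S \<Longrightarrow> {s, u} \<in> defining_diagram_edges W S \<Longrightarrow> \<phi> u = u"
    using assms(1) by (auto simp: flexible_def)
  have "\<phi> \<in> extensional S"
    using \<phi> by (auto simp: defining_diagram_automorphisms_def graph_aut_group_def Bij_def)
  then have \<phi>': "coxeter_diagram_automorphism W S \<phi>" using \<phi> defining_diagram_automorphism_iff by blast
  have star: "\<phi> u = u" if "u \<in> S" "u = s \<or> coxeter_order W s u < \<infinity>" for u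
    using that nb[of u] \<phi>s s by (cases "u = s") (auto simp: defining_diagram_edge_iff)
  \<comment> \<open>A vertex moved by \<phi> lies outside the star of \<open>s\<close>.\<close>
  have st: "s \<noteq> t" "coxeter_order W s t = \<infinity>"
    using star[OF t(1)] t(2) by (blast, cases "coxeter_order W s t") auto
  let ?P = "generate W (S - {s})"
  have "\<forall>x\<in>carrier W. \<exists>ws. ws \<in> lists S \<and> val ws = x" using val_surj by blast
  from bchoice[OF this] obtain wd
    where wd: "\<And>x. x \<in> carrier W \<Longrightarrow> wd x \<in> lists S \<and> val (wd x) = x" by blast
  \<comment> \<open>The coset has to miss whole paths from \<open>\<one>\<close> to the points of
    \<open>F\<close>: only then does every step of such a path carry the trivial twist.\<close>
  define F' where "F' = (\<Union>x\<in>F. (\<lambda>i. val (take i (wd x))) ` {..length (wd x)})"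
  have "finite F'" using assms(2) by (simp add: F'_def)
  from coset_avoiding_finite_set[OF s t(1) st this] obtain c
    where c: "c \<in> carrier W" "\<And>p. p \<in> ?P \<Longrightarrow> c \<otimes> p \<notin> F'" by blast
  have sub: "subgroup ?P W" by (intro generate_is_subgroup) auto
  define B where "B = {x \<in> carrier W. inv c \<otimes> x \<in> ?P}"
  have B: "x \<otimes> u \<in> B \<longleftrightarrow> x \<in> B" if "x \<in> carrier W" "u \<in> S" "u \<noteq> s" for x u
  proof -
    have u: "u \<in> ?P" using that by (auto intro: generate.incl)
    have cx: "inv c \<otimes> (y \<otimes> u) = inv c \<otimes> y \<otimes> u" if "y \<in> carrier W" for y
      using c \<open>u \<in> S\<close> that by (simp add: m_assoc)
    have "x \<otimes> u \<in> B" if "x \<in> B" for x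
      using that u cx \<open>u \<in> S\<close> sub by (simp add: B_def subgroup.m_closed)
    from this[of x] this[of "x \<otimes> u"] show ?thesis
      using generator_cancel_right[OF that(2,1)] by auto
  qed
  have BF: "x \<notin> B" if "x \<in> F'" for x
    using c(2)[of "inv c \<otimes> x"] c(1) that by (auto simp: B_def)
  obtain f where f: "cayley_aut f" "f \<one> = \<one>"
    "\<And>w t. w \<in> carrier W \<Longrightarrow> t \<in> S \<Longrightarrow> f (w \<otimes> t) = f w \<otimes> (if w \<in> B then \<phi> t else t)"
    by (rule twist_exists[OF s B \<phi>' star]) (assumption | rule that)+
  have "f x = x" if x: "x \<in> F" for x
  proof -
    have xW: "x \<in> carrier W" using x assms(3) by blast
    have "f (val (take i (wd x))) = val (take i (wd x))" if "i \<le> length (wd x)" for i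
      using that
    proof (induction i)
      case (Suc i)
      have i: "take i (wd x) \<in> lists S" "wd x ! i \<in> S"
        using wd[OF xW] Suc(2) by (auto dest: in_set_takeD)
      have "val (take (Suc i) (wd x)) = val (take i (wd x)) \<otimes> wd x ! i"
        using i Suc(2) by (simp add: take_Suc_conv_app_nth val_append)
      moreover have "val (take i (wd x)) \<in> F'" using x Suc(2) unfolding F'_def by (intro UN_I[OF x] imageI) simp
      ultimately show ?case using f(3)[OF val_closed[OF i(1)] i(2)] BF Suc by simp
    qed (simp add: f)
    from this[of "length (wd x)"] show ?thesis using wd[OF xW] by simp
  qed
  moreover have "\<exists>x\<in>carrier W. f x \<noteq> x"
  proof (rule ccontr)
    assume "\<not> ?thesis"
    then have id: "f x = x" if "x \<in> carrier W" for x using that by blast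
    \<comment> \<open>At the base point of the coset the twist sends the edge labelled
      \<open>t\<close> to one labelled \<open>\<phi> t\<close>.\<close>
    have "c \<in> B" using c(1) by (simp add: B_def generate.one)
    then have "c \<otimes> t = c \<otimes> \<phi> t" using f(3)[OF c(1) t(1)] id c(1) t(1) by simp
    moreover have "\<phi> t \<in> S" using \<phi>' t(1) by (auto simp: coxeter_diagram_automorphism_def bij_betw_def)
    ultimately show False using t c(1) by simp
  qed
  ultimately show thesis using that f(1) by blast
qed

subsection \<open>Discreteness\<close>

text \<open>A left translation followed on the inside by a homomorphism is determined by its values
  on \<open>insert \<one> S\<close>. As this set is finite, fixing those values is an open condition
  that isolates each automorphism.\<close>

lemma decomposition_imp_discrete:
  assumes fin: "finite S"
    and dec: "\<forall>f \<in> carrier (cayley_aut_group W S).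
            \<exists>l \<in> left_mult_automorphisms W. \<exists>\<delta> \<in> diagram_automorphisms W S.
              f = l \<otimes>\<^bsub>cayley_aut_group W S\<^esub> \<delta>"
  shows "cayley_aut_topology W S = discrete_topology (carrier (cayley_aut_group W S))"
proof -
  let ?A = "carrier (cayley_aut_group W S)" and ?V = "carrier W"
  let ?T = "product_topology (\<lambda>_. discrete_topology ?V) ?V"
  have rigid: "f = h" if fh: "f \<in> ?A" "h \<in> ?A" "\<And>x. x \<in> insert \<one> S \<Longrightarrow> f x = h x" for f h
  proof -
    have form: "\<exists>\<delta>. \<delta> \<in> hom W W \<and> (\<forall>x\<in>?V. k x = k \<one> \<otimes> \<delta> x) \<and> k \<one> \<in> ?V" if k: "k \<in> ?A" for k
    proof -
      obtain w \<delta> where w: "w \<in> ?V" and \<delta>: "\<delta> \<in> diagram_automorphisms W S"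
        and k: "k = left_mult W w \<otimes>\<^bsub>cayley_aut_group W S\<^esub> \<delta>"
        using bspec[OF dec k] unfolding left_mult_automorphisms_def by blast
      have hom: "\<delta> \<in> hom W W" and bij: "\<delta> \<in> Bij ?V"
        using \<delta> by (auto simp: diagram_automorphisms_def auto_def)
      have kx: "k x = w \<otimes> \<delta> x" if "x \<in> ?V" for x
        using cayley_aut_group_mult[OF w bij that] k by simp
      moreover have "\<delta> \<one> = \<one>" using hom_one[OF hom] is_group by simp
      ultimately have "k \<one> = w" using w by simp
      then show ?thesis using kx hom w by blast
    qed
    obtain \<delta> where \<delta>: "\<delta> \<in> hom W W" "\<And>x. x \<in> ?V \<Longrightarrow> f x = f \<one> \<otimes> \<delta> x" "f \<one> \<in> ?V"
      using form[OF fh(1)] by blast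
    obtain \<epsilon> where \<epsilon>: "\<epsilon> \<in> hom W W" "\<And>x. x \<in> ?V \<Longrightarrow> h x = h \<one> \<otimes> \<epsilon> x"
      using form[OF fh(2)] by blast
    have one: "f \<one> = h \<one>" using fh(3) by simp
    have c: "\<delta> x \<in> ?V" "\<epsilon> x \<in> ?V" if "x \<in> ?V" for x
      using \<delta>(1) \<epsilon>(1) that by (auto simp: hom_def)
    have gen: "\<delta> s = \<epsilon> s" if "s \<in> S" for s
    proof -
      have "f \<one> \<otimes> \<delta> s = f \<one> \<otimes> \<epsilon> s"
        using \<delta>(2)[of s] \<epsilon>(2)[of s] fh(3)[of s] one that by auto
      then show ?thesis using c[of s] \<delta>(3) that by simp
    qed
    have "\<delta> x = \<epsilon> x" if "x \<in> ?V" for x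
      using that
    proof (induction rule: generator_induct)
      case one
      then show ?case using hom_one[OF \<delta>(1)] hom_one[OF \<epsilon>(1)] is_group by simp
    next
      case (step x s)
      then show ?case using gen \<delta>(1) \<epsilon>(1) by (simp add: hom_mult)
    qed
    then have "f x = h x" if "x \<in> ?V" for x
      using \<delta>(2)[OF that] \<epsilon>(2)[OF that] one that by metis
    then show "f = h"
      using fh(1,2) unfolding cayley_aut_group_carrier by (blast intro: extensionalityI)
  qed
  have AV: "?A \<subseteq> ?V \<rightarrow>\<^sub>E ?V"
  proof
    fix f assume "f \<in> ?A"
    then show "f \<in> ?V \<rightarrow>\<^sub>E ?V"
      unfolding cayley_aut_group_carrier PiE_def using cayley_aut_closed by blast
  qed
  have "openin (cayley_aut_topology W S) {f}" if f: "f \<in> ?A" for f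
  proof -
    define U where "U x = (if x \<in> insert \<one> S then {f x} else ?V)" for x
    have "openin ?T (PiE ?V U)"
      unfolding openin_product_topology_alt
    proof (intro ballI exI[of _ U] conjI)
      show "finite {i \<in> ?V. U i \<noteq> topspace (discrete_topology ?V)}"
        by (rule finite_subset[of _ "insert \<one> S"]) (use fin in \<open>auto simp: U_def\<close>)
      show "openin (discrete_topology ?V) (U i)" if "i \<in> ?V" for i
        using PiE_mem[OF subsetD[OF AV f] that] by (simp add: U_def)
    qed simp_all
    moreover have "{f} = PiE ?V U \<inter> ?A"
    proof -
      have "f \<in> PiE ?V U" using subsetD[OF AV f] by (simp add: U_def PiE_iff)
      moreover have "h = f" if "h \<in> PiE ?V U" "h \<in> ?A" for h
      proof (rule rigid[OF that(2) f])
        fix x assume x: "x \<in> insert \<one> S"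
        then have "h x \<in> U x" using that(1) by (auto simp: PiE_iff)
        then show "h x = f x" using x by (simp add: U_def)
      qed
      ultimately show ?thesis using f by blast
    qed
    ultimately show ?thesis
      unfolding cayley_aut_topology_def graph_aut_topology_def cayley_aut_group_def openin_subtopology
      by blast
  qed
  moreover have "topspace (cayley_aut_topology W S) = ?A"
    using AV by (simp add: cayley_aut_topology_def graph_aut_topology_def cayley_aut_group_def Int_absorb1)
  ultimately show ?thesis
    using discrete_topology_unique[of ?A "cayley_aut_topology W S"] by metis
qed

text \<open>If the identity were isolated, a finite set of coordinates would determine it; a twist
  supported away from those coordinates is a second automorphism in the same neighbourhood.\<close>

lemma discrete_imp_not_flexible:
  assumes disc: "cayley_aut_topology W S = discrete_topology (carrier (cayley_aut_group W S))"
  shows "\<not> flexible W S"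
proof
  assume flex: "flexible W S"
  let ?A = "carrier (cayley_aut_group W S)" and ?V = "carrier W"
  let ?T = "product_topology (\<lambda>_. discrete_topology ?V) ?V" and ?id = "\<lambda>x\<in>?V. x"
  have id: "?id \<in> ?A"
    using id_Bij[of ?V] by (auto simp: cayley_aut_group_carrier cayley_aut_def Bij_def)
  then have "openin (cayley_aut_topology W S) {?id}" by (simp add: disc)
  then obtain O' where O': "openin ?T O'" "{?id} = O' \<inter> ?A"
    unfolding cayley_aut_topology_def graph_aut_topology_def cayley_aut_group_def
    by (auto simp: openin_subtopology)
  then have "?id \<in> O'" by blast
  with O'(1) obtain U where U: "finite {i \<in> ?V. U i \<noteq> ?V}" "?id \<in> PiE ?V U" "PiE ?V U \<subseteq> O'"
    unfolding openin_product_topology_alt by (auto simp del: restrict_apply)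
  obtain f where f: "cayley_aut f" "\<forall>x\<in>{i \<in> ?V. U i \<noteq> ?V}. f x = x" "\<exists>x\<in>?V. f x \<noteq> x"
    using flexible_small_automorphism[OF flex U(1)] by blast
  let ?f = "restrict f ?V"
  have "cayley_aut ?f"
    using f(1) by (auto simp: cayley_aut_def bij_betw_restrict_eq)
  then have "?f \<in> ?A" by (simp add: cayley_aut_group_carrier)
  moreover have "?f \<in> PiE ?V U"
  proof (rule PiE_I)
    fix x assume x: "x \<in> ?V"
    show "?f x \<in> U x"
    proof (cases "U x = ?V")
      case True
      then show ?thesis using f(1) x by auto
    next
      case False
      then have "f x = x" using f(2) x by blast
      moreover have "?id x \<in> U x" using U(2) x by (rule PiE_mem)
      ultimately show ?thesis using x by simp
    qed
  qed simp
  ultimately have "?f = ?id" using U(3) O'(2) by blast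
  then have "f x = x" if "x \<in> ?V" for x
    using that by (auto dest: fun_cong[of _ _ x])
  then show False using f(3) by blast
qed

end

theorem theorem1:
  fixes W :: "('a, 'b) monoid_scheme" and S :: "'a set"
  assumes "coxeter_system W S" and "finite S"
  shows "((\<forall>f \<in> carrier (cayley_aut_group W S).
            \<exists>l \<in> left_mult_automorphisms W. \<exists>\<delta> \<in> diagram_automorphisms W S.
              f = l \<otimes>\<^bsub>cayley_aut_group W S\<^esub> \<delta>)
          \<longleftrightarrow> \<not> flexible W S) \<and>
         (cayley_aut_topology W S = discrete_topology (carrier (cayley_aut_group W S))
          \<longleftrightarrow> \<not> flexible W S)"
proof -
  interpret group W using assms(1) by (simp add: coxeter_system_def has_presentation_def)
  interpret coxeter W S using assms(1) by unfold_locales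
  \<comment> \<open>Non-flexibility gives the decomposition, the decomposition gives discreteness,
    and discreteness gives non-flexibility; this cycle contains both equivalences.\<close>
  show ?thesis
    using rigid_decomposition decomposition_imp_discrete[OF assms(2)] discrete_imp_not_flexible
    by blast
qed

end
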